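(* For all $n\geq1$ and $k\geq1$, the map $\psi$ is a bijection from the set of parallelogram polyominoes of area $n$ with $k$ columns to the set of coin fountains with $n$ coins in the even-numbered rows and $n-k$ coins in the odd-numbered rows.
   Context: A parallelogram polyomino is a finite set of unit cells bounded by two non-intersecting lattice paths with north and east steps having the same endpoints; equivalently it has columns $1,\dots,k$ (left to right), column $i$ being a vertical segment of $c_i\ge1$ cells, such that for $i<k$ column $i+1$ starts weakly above the start of column $i$ and ends weakly above the end of column $i$, sharing $o_i\ge1$ rows with column $i$. Its area is its number of cells. Let $h(P)$ be the Dyck path (steps $u=(1,1)$, $d=(1,-1)$) $u^{c_1}d^{c_1-o_1+1}u^{c_2-o_1+1}d^{c_2-o_2+1}\cdots u^{c_k-o_{k-1}+1}d^{c_k}$ (the Delest–Viennot bijection: $k$ peaks of heights $c_1,\dots,c_k$, valleys of heights $o_i-1$). Stanley polyominoes: cells $[i,i+1]\times[j,j+1]$; a Stanley polyomino (up to translation) has rows $0,\dots,m-1$ (bottom to top), row $j$ consisting of cells with $s_j\le i\le e_j$, with $s_{j-1}<s_j\le e_{j-1}<e_j$. For such $Q$ with $m$ rows, let $a_1=e_0-s_0$, $a_{j+1}=e_j-e_{j-1}$ ($1\le j\le m-1$), $b_m=e_{m-1}-s_{m-1}$, $b_{j}=s_{j}-s_{j-1}$ ($1\le j\le m-1$); then $\phi(Q)=u^{a_1}d^{b_1}u^{a_2}d^{b_2}\cdots u^{a_m}d^{b_m}$. The map $\phi$ is a bijection from Stanley polyominoes with $N+1$ columns to Dyck paths of semilength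 $N$. Coin fountains: a coin fountain with $d\ge1$ diagonals is a finite $C\subset\mathbb{Z}\times\mathbb{Z}_{\ge0}$ with row $0$ equal to $\{(2i,0):0\le i\le d-1\}$ such that each $(a,j)\in C$ with $j\ge1$ has $(a\pm1,j-1)\in C$. Rows are numbered $0,1,2,\dots$ from the bottom (so the bottom row is even-numbered). The first north-east diagonal is the set of coins $(j,j)\in C$, $\mathrm{diag}(C)$ its size, and $C'=\{(a-2,j):(a,j)\in C,\ a-j\ge2\}$ (for $d\ge2$). The map $f$ from coin fountains to Stanley polyominoes: a single coin maps to a row of two cells; for $d\ge2$ with $k=\mathrm{diag}(C)$ and $P'=f(C')$: if $k=2\ell+1$, add below $P'$ a new bottom row occupying $s_0-1\le i\le s_0+\ell$; if $k=2\ell$ ($\ell\ge1$), add one cell at the left end of each of the $\ell$ lowest rows of $P'$. The map $f$ is a bijection from coin fountains onto Stanley polyominoes with at least two columns. Finally $\psi(P)=f^{-1}(\phi^{-1}(h(P)))$. *)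

theory Defs
  imports Main
begin

text \<open>
  The cell $[i,i+1]\times[j,j+1]$ is represented by its lower left corner \<open>(i, j)\<close>. Polyominoes
  are considered up to translation, so each translation class is represented by one normalized set
  of cells: parallelogram polyominoes have leftmost column \<open>1\<close> whose lowest cell is in row \<open>0\<close>;
  Stanley polyominoes have lowest row \<open>0\<close> whose leftmost cell is in column \<open>0\<close>.
\<close>

type_synonym cell = "int \<times> int"

definition num_columns :: "cell set \<Rightarrow> nat" where
  "num_columns P = card (fst ` P)"

definition num_rows :: "cell set \<Rightarrow> nat" where
  "num_rows P = card (snd ` P)"

definition area :: "cell set \<Rightarrow> nat" where
  "area P = card P"

text \<open>Dyck paths are words in the steps $u = (1,1)$ and $d = (1,-1)$.\<close>

datatype step = Up | Down


subsection \<open>Parallelogram polyominoes\<close>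

definition parallelogram_polyomino :: "cell set \<Rightarrow> bool" where
  "parallelogram_polyomino P \<longleftrightarrow>
     (\<exists>(k::nat) (lo::nat \<Rightarrow> int) (hi::nat \<Rightarrow> int).
        k \<ge> 1 \<and> lo 1 = 0 \<and>
        (\<forall>i. 1 \<le> i \<and> i \<le> k \<longrightarrow> lo i \<le> hi i) \<and>
        (\<forall>i. 1 \<le> i \<and> i < k \<longrightarrow>
           lo i \<le> lo (i + 1) \<and> hi i \<le> hi (i + 1) \<and> lo (i + 1) \<le> hi i) \<and>
        P = {(int i, j) | i j. 1 \<le> i \<and> i \<le> k \<and> lo i \<le> j \<and> j \<le> hi i})"

definition column :: "cell set \<Rightarrow> nat \<Rightarrow> int set" where
  "column P i = {j. (int i, j) \<in> P}"

definition column_length :: "cell set \<Rightarrow> nat \<Rightarrow> nat" where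
  "column_length P i = card (column P i)"

definition column_overlap :: "cell set \<Rightarrow> nat \<Rightarrow> nat" where
  "column_overlap P i = card (column P i \<inter> column P (i + 1))"

text \<open>
  The Delest--Viennot map. The natural number subtractions are exact, because an overlap is never
  longer than either of the two columns involved.
\<close>

definition delest_viennot :: "cell set \<Rightarrow> step list" where
  "delest_viennot P =
     (let k = num_columns P; c = column_length P; r = column_overlap P in
      concat (map (\<lambda>i.
          replicate (if i = 1 then c 1 else c i - r (i - 1) + 1) Up @
          replicate (if i = k then c k else c i - r i + 1) Down) [1..<k + 1]))"


subsection \<open>Stanley polyominoes\<close>

definition stanley_polyomino :: "cell set \<Rightarrow> bool" where
  "stanley_polyomino Q \<longleftrightarrow>
     (\<exists>(m::nat) (s::nat \<Rightarrow> int) (e::nat \<Rightarrow> int).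
        m \<ge> 1 \<and> s 0 = 0 \<and>
        (\<forall>j<m. s j \<le> e j) \<and>
        (\<forall>j. 1 \<le> j \<and> j < m \<longrightarrow> s (j - 1) < s j \<and> s j \<le> e (j - 1) \<and> e (j - 1) < e j) \<and>
        Q = {(i, int j) | i j. j < m \<and> s j \<le> i \<and> i \<le> e j})"

definition row_start :: "cell set \<Rightarrow> nat \<Rightarrow> int" where
  "row_start Q j = Min {i. (i, int j) \<in> Q}"

definition row_end :: "cell set \<Rightarrow> nat \<Rightarrow> int" where
  "row_end Q j = Max {i. (i, int j) \<in> Q}"

text \<open>The \<open>j\<close>-th block below, for \<open>j < m\<close>, is $u^{a_{j+1}} d^{b_{j+1}}$.\<close>

definition stanley_to_dyck :: "cell set \<Rightarrow> step list" where
  "stanley_to_dyck Q =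
     (let m = num_rows Q; s = row_start Q; e = row_end Q in
      concat (map (\<lambda>j.
          replicate (nat (if j = 0 then e 0 - s 0 else e j - e (j - 1))) Up @
          replicate (nat (if j = m - 1 then e (m - 1) - s (m - 1) else s (j + 1) - s j)) Down)
        [0..<m]))"


subsection \<open>Coin fountains\<close>

type_synonym coin = "int \<times> nat"

definition num_diagonals :: "coin set \<Rightarrow> nat" where
  "num_diagonals C = card {a. (a, 0) \<in> C}"

definition coin_fountain :: "coin set \<Rightarrow> bool" where
  "coin_fountain C \<longleftrightarrow>
     finite C \<and>
     (\<exists>d::nat. d \<ge> 1 \<and> {a. (a, 0) \<in> C} = {2 * int i | i. i < d}) \<and>
     (\<forall>a j. (a, j) \<in> C \<and> j \<ge> 1 \<longrightarrow> (a - 1, j - 1) \<in> C \<and> (a + 1, j - 1) \<in> C)"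

definition first_diagonal_size :: "coin set \<Rightarrow> nat" where
  "first_diagonal_size C = card {j. (int j, j) \<in> C}"

definition remove_first_diagonal :: "coin set \<Rightarrow> coin set" where
  "remove_first_diagonal C = {(a - 2, j) | a j. (a, j) \<in> C \<and> a - int j \<ge> 2}"

definition even_coins :: "coin set \<Rightarrow> nat" where
  "even_coins C = card {(a, j). (a, j) \<in> C \<and> even j}"

definition odd_coins :: "coin set \<Rightarrow> nat" where
  "odd_coins C = card {(a, j). (a, j) \<in> C \<and> odd j}"


subsection \<open>From coin fountains to Stanley polyominoes\<close>

definition normalize_cells :: "cell set \<Rightarrow> cell set" where
  "normalize_cells Q = (\<lambda>(i, j). (i - Min (fst ` Q), j - Min (snd ` Q))) ` Q"

text \<open>Both operations take a normalized polyomino, whose lowest row is row \<open>0\<close>.\<close>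

definition add_bottom_row :: "nat \<Rightarrow> cell set \<Rightarrow> cell set" where
  "add_bottom_row l Q =
     normalize_cells
       (Q \<union> {(i, -1) | i. row_start Q 0 - 1 \<le> i \<and> i \<le> row_start Q 0 + int l})"

definition extend_lowest_rows :: "nat \<Rightarrow> cell set \<Rightarrow> cell set" where
  "extend_lowest_rows l Q =
     normalize_cells (Q \<union> {(row_start Q j - 1, int j) | j. j < l})"

text \<open>
  The first argument is the number of diagonals of the fountain; the equation for \<open>0\<close> is irrelevant.
\<close>

fun fountain_to_stanley_rec :: "nat \<Rightarrow> coin set \<Rightarrow> cell set" where
  "fountain_to_stanley_rec 0 C = {}"
| "fountain_to_stanley_rec (Suc 0) C = {(0, 0), (1, 0)}"
| "fountain_to_stanley_rec (Suc (Suc d)) C =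
     (let Q = fountain_to_stanley_rec (Suc d) (remove_first_diagonal C);
          k = first_diagonal_size C
      in if odd k then add_bottom_row (k div 2) Q else extend_lowest_rows (k div 2) Q)"

definition fountain_to_stanley :: "coin set \<Rightarrow> cell set" where
  "fountain_to_stanley C = fountain_to_stanley_rec (num_diagonals C) C"


subsection \<open>The composite map\<close>

definition psi :: "cell set \<Rightarrow> coin set" where
  "psi P =
     the_inv_into {C. coin_fountain C} fountain_to_stanley
       (the_inv_into {Q. stanley_polyomino Q} stanley_to_dyck (delest_viennot P))"

end

theory Submission
  imports Defs
begin

text \<open>
  A Stanley polyomino with rows $[s_j, e_j]$, $0 \le j < m$, and at least two columns has
  $s_j < e_j$ for all $j$. Comparing exponents, its Dyck path is the Delest--Viennot path of the
  parallelogram polyomino whose column $j+1$ is $[s_j - j, e_j - j - 1]$. This shear has $m$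
  columns and area $\sum_j (e_j - s_j)$, and it inverts the passage through Dyck paths.

  Under $f$, a new first diagonal of size $k$ increases $\sum_j (e_j - s_j)$ by
  $\lceil k/2 \rceil$ and $\sum_j (e_j - s_j) - m$ by $\lfloor k/2 \rfloor$, that is, by its
  numbers of coins in even and in odd rows. A fountain amounts to its sequence of diagonal sizes,
  in which each is at most one more than the next, so $f$ is bijective once the size $k$ of the
  first diagonal can be read off its image. It can: with $a = e_0 - s_0$ and $r$ the
  least index such that $b_r \ge 2$ ($r = \infty$ if there is none),
  $k = \min(2a - 1, 2r)$.
\<close>

subsection \<open>Row data of Stanley polyominoes\<close>

definition row_cells :: "nat \<Rightarrow> (nat \<Rightarrow> int) \<Rightarrow> (nat \<Rightarrow> int) \<Rightarrow> cell set" where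
  "row_cells m s e = {(i, int j) | i j. j < m \<and> s j \<le> i \<and> i \<le> e j}"

text \<open>Row data, normalised as for Stanley polyominoes, in which every row has at least two
  cells. Only the single cell is excluded, so this describes the expected range of
  \<open>fountain_to_stanley\<close>. Values from \<open>m\<close> on are left
  unconstrained.\<close>

definition wide_rows :: "nat \<Rightarrow> (nat \<Rightarrow> int) \<Rightarrow> (nat \<Rightarrow> int) \<Rightarrow> bool" where
  "wide_rows m s e \<longleftrightarrow> 1 \<le> m \<and> s 0 = 0 \<and> (\<forall>j<m. s j < e j) \<and>
     (\<forall>j. Suc j < m \<longrightarrow> s j < s (Suc j) \<and> s (Suc j) \<le> e j \<and> e j < e (Suc j))"

lemma mem_row_cells [simp]:
  "(i, j) \<in> row_cells m s e \<longleftrightarrow> 0 \<le> j \<and> nat j < m \<and> s (nat j) \<le> i \<and> i \<le> e (nat j)"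
  unfolding row_cells_def by (auto intro!: exI[of _ "nat j"])

lemma wide_rowsD:
  assumes "wide_rows m s e"
  shows "1 \<le> m" "s 0 = 0" "\<And>j. j < m \<Longrightarrow> s j < e j"
    "\<And>j. Suc j < m \<Longrightarrow> s j < s (Suc j)" "\<And>j. Suc j < m \<Longrightarrow> s (Suc j) \<le> e j"
    "\<And>j. Suc j < m \<Longrightarrow> e j < e (Suc j)"
  using assms unfolding wide_rows_def by auto

text \<open>Integers that grow strictly grow by at least 1 in each row. Equality
  \<open>s j = int j\<close> up to some row thus says that all earlier exponents b are 1.\<close>

lemma wide_rows_lower:
  assumes "wide_rows m s e" "j < m"
  shows "int j \<le> s j" "e 0 + int j \<le> e j"
  using assms(2)
proof (induction j)
  case (Suc j)
  case 1
  then show ?case using Suc.IH(1) wide_rowsD(4)[OF assms(1), of j] by simp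
next
  case (Suc j)
  case 2
  then show ?case using Suc.IH(2) wide_rowsD(6)[OF assms(1), of j] by simp
qed (use wide_rowsD(2)[OF assms(1)] in auto)

lemma finite_row_cells [simp]: "finite (row_cells m s e)"
proof -
  have "row_cells m s e = (\<Union>j<m. (\<lambda>i. (i, int j)) ` {s j..e j})"
    unfolding row_cells_def by auto
  then show ?thesis by simp
qed

lemma row_cells_cong:
  assumes "\<And>j. j < m \<Longrightarrow> s j = s' j" "\<And>j. j < m \<Longrightarrow> e j = e' j"
  shows "row_cells m s e = row_cells m s' e'"
  using assms by auto

lemma row_start_row_cells:
  assumes "j < m" "s j \<le> e j"
  shows "row_start (row_cells m s e) j = s j"
proof -
  have "{i. (i, int j) \<in> row_cells m s e} = {s j..e j}" using assms by auto
  then show ?thesis unfolding row_start_def using assms by (auto intro!: Min_eqI)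
qed

lemma row_end_row_cells:
  assumes "j < m" "s j \<le> e j"
  shows "row_end (row_cells m s e) j = e j"
proof -
  have "{i. (i, int j) \<in> row_cells m s e} = {s j..e j}" using assms by auto
  then show ?thesis unfolding row_end_def using assms by (auto intro!: Max_eqI)
qed

lemma num_rows_row_cells:
  assumes "\<And>j. j < m \<Longrightarrow> s j \<le> e j"
  shows "num_rows (row_cells m s e) = m"
proof -
  have "snd ` row_cells m s e = int ` {..<m}"
    using assms unfolding row_cells_def by (force simp: image_iff)
  then show ?thesis unfolding num_rows_def by (simp add: card_image)
qed

text \<open>The data are recovered through \<open>num_rows\<close>, \<open>row_start\<close> and
  \<open>row_end\<close>. Agreement is claimed only below \<open>m\<close>, since total functions
  may differ beyond the last row.\<close>

lemma row_cells_inject: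
  assumes "wide_rows m s e" "wide_rows m' s' e'" "row_cells m s e = row_cells m' s' e'"
  shows "m = m'" "\<And>j. j < m \<Longrightarrow> s j = s' j" "\<And>j. j < m \<Longrightarrow> e j = e' j"
proof -
  have le: "s j \<le> e j" if "j < m" for j using wide_rowsD(3)[OF assms(1) that] by simp
  have le': "s' j \<le> e' j" if "j < m'" for j using wide_rowsD(3)[OF assms(2) that] by simp
  show m: "m = m'"
    using num_rows_row_cells[of m s e] num_rows_row_cells[of m' s' e'] le le' assms(3) by simp
  show "s j = s' j" "e j = e' j" if "j < m" for j
    using that m le[of j] le'[of j] assms(3)
    by (metis row_start_row_cells, metis row_end_row_cells)
qed

text \<open>With two or more rows every row is wide: \<open>s 0 < s 1 \<le> e 0\<close> for the
  lowest one and \<open>s (Suc i) \<le> e i < e (Suc i)\<close> for the others. A single row fails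
  to be wide only if it is one cell.\<close>

lemma stanley_polyomino_cases:
  assumes "stanley_polyomino Q"
  obtains "Q = {(0, 0)}" | m s e where "wide_rows m s e" "Q = row_cells m s e"
proof -
  from assms obtain m s e where m: "m \<ge> 1" "s 0 = 0" and le: "\<forall>j<m. s j \<le> e j"
    and st: "\<forall>j. 1 \<le> j \<and> j < m \<longrightarrow> s (j - 1) < s j \<and> s j \<le> e (j - 1) \<and> e (j - 1) < e j"
    and Q: "Q = row_cells m s e"
    unfolding stanley_polyomino_def row_cells_def by blast
  have st': "s j < s (Suc j)" "s (Suc j) \<le> e j" "e j < e (Suc j)" if "Suc j < m" for j
    using st[rule_format, of "Suc j"] that by auto
  show thesis
  proof (cases "m = 1 \<and> e 0 = 0")
    case True
    then have "Q = {(0, 0)}" using m unfolding Q by auto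
    then show thesis by (rule that(1))
  next
    case False
    have "s j < e j" if j: "j < m" for j
    proof (cases j)
      case 0
      then show ?thesis
      proof (cases "m = 1")
        case True
        then show ?thesis using 0 False m le by force
      next
        case F: False
        then show ?thesis using st'[of 0] 0 m by simp
      qed
    next
      case (Suc i)
      then show ?thesis using st'[of i] j by simp
    qed
    then have "wide_rows m s e" unfolding wide_rows_def using m st' by auto
    then show thesis using Q by (rule that(2))
  qed
qed

lemma stanley_polyomino_row_cells:
  assumes "wide_rows m s e"
  shows "stanley_polyomino (row_cells m s e)"
  unfolding stanley_polyomino_def
proof (intro exI conjI)
  show "\<forall>j. 1 \<le> j \<and> j < m \<longrightarrow> s (j - 1) < s j \<and> s j \<le> e (j - 1) \<and> e (j - 1) < e j"
  proof (intro allI impI)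
    fix j assume "1 \<le> j \<and> j < m"
    then show "s (j - 1) < s j \<and> s j \<le> e (j - 1) \<and> e (j - 1) < e j"
      using wide_rowsD(4-6)[OF assms, of "j - 1"] by simp
  qed
qed (use wide_rowsD(1-3)[OF assms] in \<open>auto simp: row_cells_def intro: less_imp_le\<close>)

subsection \<open>Reading off the blocks of a Dyck word\<close>

definition blocks_word :: "(nat \<times> nat) list \<Rightarrow> step list" where
  "blocks_word ps = concat (map (\<lambda>(a, b). replicate a Up @ replicate b Down) ps)"

text \<open>Neither remainder begins with \<open>x\<close>, so both exponents are the length of the
  maximal initial run of \<open>x\<close>.\<close>

lemma replicate_append_inject:
  assumes "replicate a x @ ys = replicate b x @ zs"
    and "\<And>ys'. ys \<noteq> x # ys'" "\<And>zs'. zs \<noteq> x # zs'"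
  shows "a = b \<and> ys = zs"
  using assms(1)
proof (induction a arbitrary: b)
  case 0
  then show ?case using assms(2) by (cases b) auto
next
  case (Suc a)
  then show ?case
  proof (cases b)
    case 0
    then show ?thesis using Suc.prems assms(3) by (metis append_Cons append_Nil replicate_0 replicate_Suc)
  next
    case (Suc b')
    then show ?thesis using Suc.IH[of b'] Suc.prems by simp
  qed
qed

lemma blocks_word_not_Down:
  assumes "\<And>a b. (a, b) \<in> set ps \<Longrightarrow> 1 \<le> a \<and> 1 \<le> b"
  shows "blocks_word ps \<noteq> Down # zs"
proof (cases ps)
  case (Cons p ps')
  obtain a b where "p = (a, b)" by (cases p)
  then show ?thesis using assms[of a b] Cons by (cases a) (auto simp: blocks_word_def)
qed (simp add: blocks_word_def)

text \<open>Positive exponents make every \<open>replicate\<close> a maximal run of the word, so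
  neighbouring blocks cannot merge and the runs can be peeled off one by one.\<close>

lemma blocks_word_inject:
  assumes "blocks_word ps = blocks_word qs"
    and "\<And>a b. (a, b) \<in> set ps \<Longrightarrow> 1 \<le> a \<and> 1 \<le> b" "\<And>a b. (a, b) \<in> set qs \<Longrightarrow> 1 \<le> a \<and> 1 \<le> b"
  shows "ps = qs"
  using assms
proof (induction ps arbitrary: qs)
  case Nil
  show ?case
  proof (cases qs)
    case (Cons q qs')
    obtain a b where "q = (a, b)" by (cases q)
    then show ?thesis using Nil.prems(1) Nil.prems(3)[of a b] Cons by (auto simp: blocks_word_def)
  qed simp
next
  case (Cons p ps)
  obtain a b where p: "p = (a, b)" by (cases p)
  have ab: "1 \<le> a" "1 \<le> b" using Cons.prems(2)[of a b] p by auto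
  show ?case
  proof (cases qs)
    case Nil
    then show ?thesis using Cons.prems(1) p ab by (auto simp: blocks_word_def)
  next
    case q: (Cons q qs')
    obtain c d where q': "q = (c, d)" by (cases q)
    have cd: "1 \<le> c" "1 \<le> d" using Cons.prems(3)[of c d] q q' by auto
    have eq: "replicate a Up @ (replicate b Down @ blocks_word ps)
        = replicate c Up @ (replicate d Down @ blocks_word qs')"
      using Cons.prems(1) p q q' by (simp add: blocks_word_def)
    have 1: "a = c \<and> replicate b Down @ blocks_word ps = replicate d Down @ blocks_word qs'"
      by (rule replicate_append_inject[OF eq])
        (use ab cd in \<open>cases b; cases d; auto\<close>)+
    have 3: "ps = qs'" if "blocks_word ps = blocks_word qs'"
      using Cons.IH[OF that] Cons.prems(2,3) q by auto
    have nD: "blocks_word ps \<noteq> Down # zs" for zs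
      by (rule blocks_word_not_Down) (use Cons.prems(2) in auto)
    have nD': "blocks_word qs' \<noteq> Down # zs" for zs
      by (rule blocks_word_not_Down) (use Cons.prems(3) q in auto)
    have "b = d \<and> blocks_word ps = blocks_word qs'"
      by (rule replicate_append_inject[OF conjunct2[OF 1]]) (use nD nD' in auto)
    with 1 3 p q q' show ?thesis by simp
  qed
qed

lemma stanley_to_dyck_row_cells:
  assumes "wide_rows m s e"
  shows "stanley_to_dyck (row_cells m s e) = blocks_word (map (\<lambda>j.
     (nat (if j = 0 then e 0 else e j - e (j - 1)),
      nat (if j = m - 1 then e j - s j else s (j + 1) - s j))) [0..<m])"
proof -
  have le: "s j \<le> e j" if "j < m" for j using wide_rowsD(3)[OF assms that] by simp
  have num: "num_rows (row_cells m s e) = m" by (rule num_rows_row_cells) (rule le)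
  show ?thesis
    unfolding stanley_to_dyck_def blocks_word_def Let_def num
    using wide_rowsD(1,2)[OF assms] le[of 0]
    by (auto simp: row_start_row_cells row_end_row_cells le intro!: arg_cong[of _ _ concat])
qed

lemma stanley_to_dyck_single: "stanley_to_dyck {(0, 0)} = []"
proof -
  have "{(0::int, 0::int)} = row_cells 1 (\<lambda>_. 0) (\<lambda>_. 0)" by auto
  moreover have "num_rows {(0, 0)} = 1" by (simp add: num_rows_def)
  ultimately show ?thesis
    by (simp add: stanley_to_dyck_def Let_def row_start_row_cells row_end_row_cells)
qed

text \<open>Partial sums of the Up exponents recover the row ends, and partial sums of the Down
  exponents before the last recover the row starts. The single cell is told apart by its empty
  path.\<close>

lemma inj_on_stanley_to_dyck: "inj_on stanley_to_dyck {Q. stanley_polyomino Q}"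
proof -
  \<comment> \<open>Positivity serves twice: it licenses \<open>blocks_word_inject\<close>, and it
    ensures that \<open>nat\<close> truncates nothing.\<close>
  have pos: "1 \<le> nat (if j = 0 then e 0 else e j - e (j - 1)) \<and>
      1 \<le> nat (if j = m - 1 then e j - s j else s (j + 1) - s j)"
    if "wide_rows m s e" "j < m" for m s e j
  proof -
    have "s j < s (j + 1)" if "j \<noteq> m - 1"
      using wide_rowsD(4)[OF \<open>wide_rows m s e\<close>, of j] that \<open>j < m\<close> by simp
    then show ?thesis
      using that(2) wide_rowsD(2)[OF that(1)] wide_rowsD(3)[OF that] wide_rowsD(6)[OF that(1), of "j - 1"]
      by (cases j) (auto simp: le_nat_iff)
  qed
  have nonempty: "stanley_to_dyck (row_cells m s e) \<noteq> []" if w: "wide_rows m s e" for m s e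
  proof
    assume "stanley_to_dyck (row_cells m s e) = []"
    then have "blocks_word (map (\<lambda>j.
     (nat (if j = 0 then e 0 else e j - e (j - 1)),
      nat (if j = m - 1 then e j - s j else s (j + 1) - s j))) [0..<m]) = blocks_word []"
      by (simp add: stanley_to_dyck_row_cells[OF w] blocks_word_def)
    then have "map (\<lambda>j. (nat (if j = 0 then e 0 else e j - e (j - 1)),
      nat (if j = m - 1 then e j - s j else s (j + 1) - s j))) [0..<m] = []"
      by (rule blocks_word_inject) (use pos[OF w] in auto)
    then show False using wide_rowsD(1)[OF w] by simp
  qed
  have rows: "row_cells m s e = row_cells m' s' e'"
    if w: "wide_rows m s e" and w': "wide_rows m' s' e'"
      and eq: "stanley_to_dyck (row_cells m s e) = stanley_to_dyck (row_cells m' s' e')"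
    for m m' s s' e e'
  proof -
    note eq' = eq[unfolded stanley_to_dyck_row_cells[OF w] stanley_to_dyck_row_cells[OF w']]
    have lists: "map (\<lambda>j. (nat (if j = 0 then e 0 else e j - e (j - 1)),
          nat (if j = m - 1 then e j - s j else s (j + 1) - s j))) [0..<m]
        = map (\<lambda>j. (nat (if j = 0 then e' 0 else e' j - e' (j - 1)),
          nat (if j = m' - 1 then e' j - s' j else s' (j + 1) - s' j))) [0..<m']"
      using eq' by (rule blocks_word_inject) (use pos[OF w] pos[OF w'] in auto)
    have m: "m = m'" using arg_cong[OF lists, of length] by simp
    have at: "nat (if j = 0 then e 0 else e j - e (j - 1))
          = nat (if j = 0 then e' 0 else e' j - e' (j - 1))"
        "nat (if j = m - 1 then e j - s j else s (j + 1) - s j)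
          = nat (if j = m - 1 then e' j - s' j else s' (j + 1) - s' j)" if "j < m" for j
      using arg_cong[OF lists, of "\<lambda>xs. xs ! j"] that m by auto
    have e: "e j = e' j" if "j < m" for j using that
    proof (induction j)
      case 0
      then show ?case using at(1)[of 0] wide_rowsD(2,3)[OF w] wide_rowsD(2,3)[OF w'] m by force
    next
      case (Suc j)
      then show ?case
        using at(1)[of "Suc j"] wide_rowsD(6)[OF w, of j] wide_rowsD(6)[OF w', of j] m by simp
    qed
    have s: "s j = s' j" if "j < m" for j using that
    proof (induction j)
      case 0
      then show ?case using wide_rowsD(2)[OF w] wide_rowsD(2)[OF w'] by simp
    next
      case (Suc j)
      then show ?case
        using at(2)[of j] wide_rowsD(4)[OF w, of j] wide_rowsD(4)[OF w', of j] m
        by (simp split: if_splits)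
    qed
    show ?thesis unfolding m[symmetric] by (rule row_cells_cong) (use s e in auto)
  qed
  show ?thesis
  proof (rule inj_onI, clarify)
    fix Q Q' assume Q: "stanley_polyomino Q" "stanley_polyomino Q'"
      and eq: "stanley_to_dyck Q = stanley_to_dyck Q'"
    show "Q = Q'" using Q(1)
    proof (cases rule: stanley_polyomino_cases)
      case 1
      show ?thesis using Q(2)
        by (cases rule: stanley_polyomino_cases)
          (use 1 eq stanley_to_dyck_single nonempty in metis)+
    next
      case (2 m s e)
      show ?thesis using Q(2)
        by (cases rule: stanley_polyomino_cases)
          (use 2 eq stanley_to_dyck_single nonempty rows in metis)+
    qed
  qed
qed


subsection \<open>Shearing Stanley polyominoes into parallelogram polyominoes\<close>

text \<open>Each pair of horizontally adjacent cells in row j yields one cell of column j + 1, so a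
  column is one cell shorter than its row; the row is moved back by j. Phrased through membership,
  the map acts on cell sets without a choice of row data.\<close>

definition shear :: "cell set \<Rightarrow> cell set" where
  "shear Q = {(x, y). (x + y - 1, x - 1) \<in> Q \<and> (x + y, x - 1) \<in> Q}"

lemma mem_shear_row_cells:
  assumes "wide_rows m s e"
  shows "(int i, y) \<in> shear (row_cells m s e) \<longleftrightarrow>
    1 \<le> i \<and> i \<le> m \<and> s (i - 1) - int (i - 1) \<le> y \<and> y \<le> e (i - 1) - int i"
  unfolding shear_def by (cases i) auto

lemma column_shear:
  assumes "wide_rows m s e" "j < m"
  shows "column (shear (row_cells m s e)) (Suc j) = {s j - int j..e j - int (Suc j)}"
  using assms(2) unfolding column_def mem_shear_row_cells[OF assms(1)] by auto

lemma shear_row_cells: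
  "shear (row_cells m s e) = (\<Union>j<m. Pair (int (Suc j)) ` {s j - int j..e j - int (Suc j)})"
proof (intro equalityI subsetI)
  fix z assume "z \<in> shear (row_cells m s e)"
  then obtain x y where z: "z = (x, y)" and xy: "(x + y - 1, x - 1) \<in> row_cells m s e"
    "(x + y, x - 1) \<in> row_cells m s e"
    unfolding shear_def by blast
  define j where "j = nat (x - 1)"
  have "x = int (Suc j)" "j < m" using xy unfolding j_def by auto
  then show "z \<in> (\<Union>j<m. Pair (int (Suc j)) ` {s j - int j..e j - int (Suc j)})"
    using xy z by (auto intro!: bexI[of _ j])
qed (auto simp: shear_def)

lemma num_columns_shear:
  assumes "wide_rows m s e"
  shows "num_columns (shear (row_cells m s e)) = m"
proof -
  have "fst ` shear (row_cells m s e) = (\<lambda>j. int (Suc j)) ` {..<m}"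
  proof -
    have "{s j - int j..e j - int (Suc j)} \<noteq> {}" if "j < m" for j
      using wide_rowsD(3)[OF assms that] by simp
    then show ?thesis unfolding shear_row_cells by (fastforce simp: image_iff)
  qed
  then show ?thesis unfolding num_columns_def by (simp add: card_image inj_on_def)
qed

lemma area_shear:
  assumes "wide_rows m s e"
  shows "int (area (shear (row_cells m s e))) = (\<Sum>j<m. e j - s j)"
proof -
  have "area (shear (row_cells m s e))
      = (\<Sum>j<m. card (Pair (int (Suc j)) ` {s j - int j..e j - int (Suc j)}))"
    unfolding area_def shear_row_cells by (rule card_UN_disjoint) auto
  also have "\<dots> = (\<Sum>j<m. nat (e j - s j))"
    by (intro sum.cong refl) (simp add: card_image inj_on_def)
  finally show ?thesis
    using wide_rowsD(3)[OF assms] by (simp add: less_imp_le)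
qed

text \<open>Subtracting j turns strict growth of starts and ends into weak growth. Subtracting j + 1
  from both sides of \<open>s (Suc j) \<le> e j\<close> gives the condition that columns j + 1 and j
  + 2 share a row.\<close>

lemma parallelogram_polyomino_shear:
  assumes "wide_rows m s e"
  shows "parallelogram_polyomino (shear (row_cells m s e))"
  unfolding parallelogram_polyomino_def
proof (rule exI[of _ m], rule exI[of _ "\<lambda>i. s (i - 1) - int (i - 1)"],
    rule exI[of _ "\<lambda>i. e (i - 1) - int i"], intro conjI)
  let ?lo = "\<lambda>i. s (i - 1) - int (i - 1)" and ?hi = "\<lambda>i. e (i - 1) - int i"
  show "1 \<le> m" "?lo 1 = 0" using wide_rowsD(1,2)[OF assms] by auto
  show "\<forall>i. 1 \<le> i \<and> i \<le> m \<longrightarrow> ?lo i \<le> ?hi i"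
  proof (intro allI impI)
    fix i assume "1 \<le> i \<and> i \<le> m"
    then show "?lo i \<le> ?hi i" using wide_rowsD(3)[OF assms, of "i - 1"] by (cases i) auto
  qed
  show "\<forall>i. 1 \<le> i \<and> i < m \<longrightarrow>
      ?lo i \<le> ?lo (i + 1) \<and> ?hi i \<le> ?hi (i + 1) \<and> ?lo (i + 1) \<le> ?hi i"
  proof (intro allI impI)
    fix i assume "1 \<le> i \<and> i < m"
    then show "?lo i \<le> ?lo (i + 1) \<and> ?hi i \<le> ?hi (i + 1) \<and> ?lo (i + 1) \<le> ?hi i"
      using wide_rowsD(4-6)[OF assms, of "i - 1"] by (cases i) auto
  qed
  show "shear (row_cells m s e) = {(int i, j) | i j. 1 \<le> i \<and> i \<le> m \<and> ?lo i \<le> j \<and> j \<le> ?hi i}"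
  proof (intro equalityI subsetI)
    fix z assume "z \<in> shear (row_cells m s e)"
    then obtain j y where "j < m" "z = (int (Suc j), y)" "s j - int j \<le> y \<and> y \<le> e j - int (Suc j)"
      unfolding shear_row_cells by auto
    then show "z \<in> {(int i, j) | i j. 1 \<le> i \<and> i \<le> m \<and> ?lo i \<le> j \<and> j \<le> ?hi i}"
      by (auto intro!: exI[of _ "Suc j"])
  qed (auto simp: mem_shear_row_cells[OF assms])
qed

lemma parallelogram_polyomino_imp_shear:
  assumes "parallelogram_polyomino P"
  obtains m s e where "wide_rows m s e" "P = shear (row_cells m s e)"
proof -
  from assms obtain k lo hi where k: "k \<ge> (1::nat)" "lo 1 = (0::int)"
    and le: "\<And>i. 1 \<le> i \<and> i \<le> k \<Longrightarrow> lo i \<le> (hi i :: int)"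
    and st: "\<And>i. 1 \<le> i \<and> i < k \<Longrightarrow> lo i \<le> lo (i + 1) \<and> hi i \<le> hi (i + 1) \<and> lo (i + 1) \<le> hi i"
    and P: "P = {(int i, j) | i j. 1 \<le> i \<and> i \<le> k \<and> lo i \<le> j \<and> j \<le> hi i}"
    unfolding parallelogram_polyomino_def by blast
  \<comment> \<open>The shear is inverted: column j + 1 is moved right by j and gains one cell at
    its end.\<close>
  define s where "s = (\<lambda>j. lo (Suc j) + int j)"
  define e where "e = (\<lambda>j. hi (Suc j) + int (Suc j))"
  have w: "wide_rows k s e" unfolding wide_rows_def
  proof (intro conjI allI impI)
    show "1 \<le> k" "s 0 = 0" using k by (auto simp: s_def)
    show "s j < e j" if "j < k" for j using le[of "Suc j"] that by (simp add: s_def e_def)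
    fix j assume "Suc j < k"
    then show "s j < s (Suc j)" "s (Suc j) \<le> e j" "e j < e (Suc j)"
      using st[of "Suc j"] by (auto simp: s_def e_def)
  qed
  have "P = shear (row_cells k s e)"
  proof (intro equalityI subsetI)
    fix z assume "z \<in> P"
    then obtain i y where "z = (int i, y)" "1 \<le> i \<and> i \<le> k \<and> lo i \<le> y \<and> y \<le> hi i"
      unfolding P by auto
    then show "z \<in> shear (row_cells k s e)"
      by (simp add: mem_shear_row_cells[OF w]) (simp add: s_def e_def)
  next
    fix z assume "z \<in> shear (row_cells k s e)"
    then obtain j y where "j < k" "z = (int (Suc j), y)" "s j - int j \<le> y \<and> y \<le> e j - int (Suc j)"
      unfolding shear_row_cells by auto
    then show "z \<in> P" unfolding P s_def e_def
      by (auto intro!: exI[of _ "Suc j"])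
  qed
  with w show thesis by (rule that)
qed

text \<open>Column j + 1 has length \<open>e j - s j\<close> and overlaps the next one in
  \<open>e j - s (Suc j) + 1\<close> rows. In the expressions c - o + 1 the mixed terms cancel,
  leaving \<open>e j - e (j - 1)\<close> for Up and \<open>s (j + 1) - s j\<close> for Down.\<close>

lemma delest_viennot_shear:
  assumes w: "wide_rows m s e"
  shows "delest_viennot (shear (row_cells m s e)) = stanley_to_dyck (row_cells m s e)"
proof -
  let ?P = "shear (row_cells m s e)"
  have len: "column_length ?P (Suc j) = nat (e j - s j)" if "j < m" for j
    unfolding column_length_def column_shear[OF w that] by simp
  have ov: "column_overlap ?P (Suc j) = nat (e j - s (Suc j) + 1)" if "Suc j < m" for j
  proof -
    have j: "j < m" using that by simp
    have "column ?P (Suc j) \<inter> column ?P (Suc (Suc j)) = {s (Suc j) - int (Suc j)..e j - int (Suc j)}"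
      unfolding column_shear[OF w that] column_shear[OF w j]
      using wide_rowsD(4,6)[OF w that] by auto
    then show ?thesis unfolding column_overlap_def by (simp add: algebra_simps)
  qed
  have idx: "[1..<m + 1] = map Suc [0..<m]" by (simp add: map_Suc_upt)
  have block: "replicate (if Suc j = 1 then column_length ?P 1
        else column_length ?P (Suc j) - column_overlap ?P (Suc j - 1) + 1) Up @
      replicate (if Suc j = m then column_length ?P m
        else column_length ?P (Suc j) - column_overlap ?P (Suc j) + 1) Down
    = replicate (nat (if j = 0 then e 0 else e j - e (j - 1))) Up @
      replicate (nat (if j = m - 1 then e j - s j else s (j + 1) - s j)) Down"
    if j: "j < m" for j
  proof -
    have "(if Suc j = 1 then column_length ?P 1
        else column_length ?P (Suc j) - column_overlap ?P (Suc j - 1) + 1)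
      = nat (if j = 0 then e 0 else e j - e (j - 1))"
    proof (cases j)
      case 0
      then show ?thesis using len[OF j] wide_rowsD(2)[OF w] by simp
    next
      case (Suc i)
      then show ?thesis
        using len[OF j] ov[of i] j wide_rowsD(4-6)[OF w, of i] wide_rowsD(3)[OF w j] by simp
    qed
    moreover have "(if Suc j = m then column_length ?P m
        else column_length ?P (Suc j) - column_overlap ?P (Suc j) + 1)
      = nat (if j = m - 1 then e j - s j else s (j + 1) - s j)"
    proof (cases "Suc j = m")
      case True
      then show ?thesis using len[OF j] by auto
    next
      case False
      then have "Suc j < m" using j by simp
      then show ?thesis
        using len[OF j] ov[of j] wide_rowsD(4-6)[OF w, of j] wide_rowsD(3)[OF w j] by auto
    qed
    ultimately show ?thesis by simp
  qed
  show ?thesis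
    unfolding delest_viennot_def stanley_to_dyck_row_cells[OF w] blocks_word_def Let_def
      num_columns_shear[OF w] idx map_map
    by (intro arg_cong[of _ _ concat] map_cong refl) (use block in simp)
qed

subsection \<open>The two insertion steps on row data\<close>

text \<open>Together with \<open>bottom_end\<close>, the row data after
  \<open>add_bottom_row\<close>. The new row starts one place left of the origin and one row below
  it, so normalisation moves the old rows up and right by 1 and the new row becomes 0 to l +
  1.\<close>

fun bottom_start :: "(nat \<Rightarrow> int) \<Rightarrow> nat \<Rightarrow> int" where
  "bottom_start s 0 = 0"
| "bottom_start s (Suc j) = s j + 1"

fun bottom_end :: "nat \<Rightarrow> (nat \<Rightarrow> int) \<Rightarrow> nat \<Rightarrow> int" where
  "bottom_end l e 0 = int l + 1"
| "bottom_end l e (Suc j) = e j + 1"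

text \<open>Row starts after \<open>extend_lowest_rows\<close>. Normalisation moves everything right
  by 1, which in the \<open>l\<close> lowest rows cancels against the cell added on the
  left.\<close>

definition extend_start :: "nat \<Rightarrow> (nat \<Rightarrow> int) \<Rightarrow> nat \<Rightarrow> int" where
  "extend_start l s j = (if j < l then s j else s j + 1)"

lemma normalize_cells_eq:
  assumes "finite Q" "\<And>i j. (i, j) \<in> Q \<Longrightarrow> x \<le> i \<and> y \<le> j" "(x, j') \<in> Q" "(i', y) \<in> Q"
  shows "normalize_cells Q = {(i, j). (i + x, j + y) \<in> Q}"
proof -
  have "Min (fst ` Q) = x" "Min (snd ` Q) = y"
    using assms by (auto intro!: Min_eqI) (force simp: image_iff)+
  then have "normalize_cells Q = (\<lambda>(i, j). (i - x, j - y)) ` Q"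
    unfolding normalize_cells_def by simp
  also have "\<dots> = {(i, j). (i + x, j + y) \<in> Q}"
    by (force simp: image_iff)
  finally show ?thesis .
qed

lemma wide_rows_origin:
  assumes "wide_rows m s e"
  shows "(0, 0) \<in> row_cells m s e"
  using wide_rowsD(1,2)[OF assms] wide_rowsD(3)[OF assms, of 0] by simp

lemma row_cells_nonneg:
  assumes "wide_rows m s e" "(i, j) \<in> row_cells m s e"
  shows "0 \<le> i" "0 \<le> j"
  using assms(2) wide_rows_lower(1)[OF assms(1), of "nat j"] by auto

lemma row_start_wide_rows:
  assumes "wide_rows m s e" "j < m"
  shows "row_start (row_cells m s e) j = s j"
  using row_start_row_cells[OF assms(2)] wide_rowsD(3)[OF assms] by simp

lemma add_bottom_row_row_cells:
  assumes w: "wide_rows m s e"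
  shows "add_bottom_row l (row_cells m s e)
    = row_cells (Suc m) (bottom_start s) (bottom_end l e)"
proof -
  let ?Q = "row_cells m s e \<union> {(i, -1) | i. -1 \<le> i \<and> i \<le> int l}"
  have "row_start (row_cells m s e) 0 = 0"
    using row_start_wide_rows[OF w, of 0] wide_rowsD(1,2)[OF w] by simp
  then have "add_bottom_row l (row_cells m s e) = normalize_cells ?Q"
    unfolding add_bottom_row_def by simp
  also have "\<dots> = {(i, j). (i + -1, j + -1) \<in> ?Q}"
  \<comment> \<open>The leftmost new cell (-1, -1) attains both minima.\<close>
  proof (rule normalize_cells_eq[of _ "-1" "-1" "-1" "-1"])
    have "{(i, -1::int) | i. -1 \<le> i \<and> i \<le> int l} = (\<lambda>i. (i, -1)) ` {-1..int l}" by auto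
    then show "finite ?Q" by simp
    show "-1 \<le> i \<and> -1 \<le> j" if "(i, j) \<in> ?Q" for i j
    proof (cases "(i, j) \<in> row_cells m s e")
      case True
      then show ?thesis using row_cells_nonneg[OF w True] by linarith
    qed (use that in auto)
    show "(-1, -1) \<in> ?Q" by auto
    then show "(-1, -1) \<in> ?Q" .
  qed
  also have "\<dots> = row_cells (Suc m) (bottom_start s) (bottom_end l e)"
  proof -
    have "(i + -1, j + -1) \<in> ?Q \<longleftrightarrow> (i, j) \<in> row_cells (Suc m) (bottom_start s) (bottom_end l e)"
      for i j
    proof
      assume "(i + -1, j + -1) \<in> ?Q"
      then consider "j = 0" "0 \<le> i" "i \<le> int l + 1" | "1 \<le> j" "(i + -1, j + -1) \<in> row_cells m s e"
        by auto
      then show "(i, j) \<in> row_cells (Suc m) (bottom_start s) (bottom_end l e)"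
      proof cases
        case 2
        then show ?thesis by (cases "nat j") (auto simp: nat_diff_distrib)
      qed simp
    next
      assume "(i, j) \<in> row_cells (Suc m) (bottom_start s) (bottom_end l e)"
      then show "(i + -1, j + -1) \<in> ?Q"
        by (cases "nat j") (auto simp: nat_diff_distrib)
    qed
    then show ?thesis by (simp only: set_eq_iff split_paired_All mem_Collect_eq case_prod_conv simp_thms)
  qed
  finally show ?thesis .
qed

lemma extend_lowest_rows_row_cells:
  assumes w: "wide_rows m s e" and l: "1 \<le> l" "l \<le> m"
  shows "extend_lowest_rows l (row_cells m s e)
    = row_cells m (extend_start l s) (\<lambda>j. e j + 1)"
proof -
  let ?Q = "row_cells m s e \<union> {(s j - 1, int j) | j. j < l}"
  have "{(row_start (row_cells m s e) j - 1, int j) | j. j < l} = {(s j - 1, int j) | j. j < l}"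
    using row_start_wide_rows[OF w] l(2) by (intro Collect_cong) (metis less_le_trans)
  then have "extend_lowest_rows l (row_cells m s e) = normalize_cells ?Q"
    unfolding extend_lowest_rows_def by simp
  also have "\<dots> = {(i, j). (i + -1, j + 0) \<in> ?Q}"
  \<comment> \<open>Since \<open>1 \<le> l\<close>, the cell (-1, 0) is added and attains the least
    column; \<open>int k \<le> s k\<close> keeps the other added cells from lying further left. The
    origin attains the least row.\<close>
  proof (rule normalize_cells_eq[of _ "-1" 0 0 0])
    have "{(s j - 1, int j) | j. j < l} = (\<lambda>j. (s j - 1, int j)) ` {..<l}" by auto
    then show "finite ?Q" by simp
    show "-1 \<le> i \<and> 0 \<le> j" if ij: "(i, j) \<in> ?Q" for i j
    proof (cases "(i, j) \<in> row_cells m s e")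
      case True
      then show ?thesis using row_cells_nonneg[OF w True] by linarith
    next
      case False
      then obtain k where "i = s k - 1" "j = int k" "k < l"
        using ij unfolding Un_iff by blast
      then show ?thesis using wide_rows_lower(1)[OF w, of k] l(2) by simp
    qed
    show "(-1, 0) \<in> ?Q" using l(1) wide_rowsD(2)[OF w] by (auto intro!: exI[of _ 0])
    show "(0, 0) \<in> ?Q" using wide_rows_origin[OF w] by blast
  qed
  also have "\<dots> = row_cells m (extend_start l s) (\<lambda>j. e j + 1)"
  proof -
    have "(i + -1, j + 0) \<in> ?Q \<longleftrightarrow> (i, j) \<in> row_cells m (extend_start l s) (\<lambda>j. e j + 1)"
      for i j
    proof
      assume "(i + -1, j + 0) \<in> ?Q"
      then consider "(i - 1, j) \<in> row_cells m s e" | k where "j = int k" "i = s k" "k < l" by auto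
      then show "(i, j) \<in> row_cells m (extend_start l s) (\<lambda>j. e j + 1)"
      proof cases
        case (2 k)
        then show ?thesis using wide_rowsD(3)[OF w, of k] l(2) by (auto simp: extend_start_def)
      qed (auto simp: extend_start_def)
    next
      assume ij: "(i, j) \<in> row_cells m (extend_start l s) (\<lambda>j. e j + 1)"
      show "(i + -1, j + 0) \<in> ?Q"
      proof (cases "nat j < l \<and> i = s (nat j)")
        case True
        then show ?thesis using ij by (auto intro!: exI[of _ "nat j"])
      next
        case False
        then show ?thesis using ij by (auto simp: extend_start_def split: if_splits)
      qed
    qed
    then show ?thesis by (simp only: set_eq_iff split_paired_All mem_Collect_eq case_prod_conv simp_thms)
  qed
  finally show ?thesis .
qed


section \<open>Reading the size of the last inserted diagonal off the row data\<close>

definition insert_diagonal :: "nat \<Rightarrow> cell set \<Rightarrow> cell set" where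
  "insert_diagonal k Q =
     (if odd k then add_bottom_row (k div 2) Q else extend_lowest_rows (k div 2) Q)"

text \<open>
  With $l = \lfloor k/2 \rfloor$: the minimum $\min(2a - 1, 2r)$ is \<open>k\<close>, where $b_j = 1$ for
  all $j < i$ is expressed as $s_j = j$ for all $j < i$. The bounds of \<open>l\<close> by \<open>m\<close> make the insertion
  of the next diagonal well defined.
\<close>

definition diagonal_code :: "nat \<Rightarrow> nat \<Rightarrow> (nat \<Rightarrow> int) \<Rightarrow> (nat \<Rightarrow> int) \<Rightarrow> bool" where
  "diagonal_code k m s e \<longleftrightarrow>
     (if odd k then k div 2 < m \<and> e 0 = int (k div 2) + 1 \<and> (\<forall>j\<le>k div 2. s j = int j)
      else 1 \<le> k div 2 \<and> k div 2 \<le> m \<and> int (k div 2) < e 0 \<and> (\<forall>j<k div 2. s j = int j) \<and>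
        (k div 2 < m \<longrightarrow> int (k div 2) < s (k div 2)))"

lemma diagonal_code_odd:
  "diagonal_code (Suc (2 * l)) m s e \<longleftrightarrow> l < m \<and> e 0 = int l + 1 \<and> (\<forall>j\<le>l. s j = int j)"
  by (simp add: diagonal_code_def)

lemma diagonal_code_even:
  "diagonal_code (2 * l) m s e \<longleftrightarrow>
     1 \<le> l \<and> l \<le> m \<and> int l < e 0 \<and> (\<forall>j<l. s j = int j) \<and> (l < m \<longrightarrow> int l < s l)"
  by (simp add: diagonal_code_def)

lemma insert_diagonal_odd: "insert_diagonal (Suc (2 * l)) Q = add_bottom_row l Q"
  by (simp add: insert_diagonal_def)

lemma insert_diagonal_even: "insert_diagonal (2 * l) Q = extend_lowest_rows l Q"
  by (simp add: insert_diagonal_def)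

lemma parity_cases:
  fixes k :: nat
  obtains l where "k = Suc (2 * l)" | l where "k = 2 * l"
  by (metis evenE oddE Suc_eq_plus1)

text \<open>Two odd codes agree because \<open>e 0\<close> fixes l. An even code 2 l' with l' < m
  puts the first departure from \<open>s j = int j\<close> at row l', so two even codes agree.
  Beside an odd code, \<open>int l' < e 0\<close> forces l' \<le> l < m, and the departure at l'
  contradicts \<open>s j = int j\<close> up to l.\<close>

lemma diagonal_code_unique:
  assumes "diagonal_code k m s e" "diagonal_code k' m s e"
  shows "k = k'"
proof -
  have oe: False if "diagonal_code (Suc (2 * l)) m s e" "diagonal_code (2 * l') m s e" for l l'
  proof -
    have "l' \<le> l" "l < m" using that unfolding diagonal_code_odd diagonal_code_even by auto
    then show False using that unfolding diagonal_code_odd diagonal_code_even by force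
  qed
  have ee: False if "diagonal_code (2 * l) m s e" "diagonal_code (2 * l') m s e" "l < l'" for l l'
    using that unfolding diagonal_code_even by force
  show ?thesis
  proof (cases k rule: parity_cases; cases k' rule: parity_cases)
    fix l l' assume "k = 2 * l" "k' = 2 * l'"
    then show "k = k'" using ee[of l l'] ee[of l' l] assms by (cases l l' rule: linorder_cases) auto
  qed (use oe assms diagonal_code_odd in auto)
qed

text \<open>With l = e_0 - 1, the first row j \<le> l where \<open>s j\<close> departs from j gives
  the code 2 j. If there is none, the code is 2 l + 1, or 2 m when the rows run out before row
  l.\<close>

lemma diagonal_code_exists:
  assumes w: "wide_rows m s e"
  shows "\<exists>k. diagonal_code k m s e"
proof -
  have e0: "0 < e 0" using wide_rowsD(1-3)[OF w] by force
  define l where "l = nat (e 0 - 1)"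
  have l: "e 0 = int l + 1" using e0 unfolding l_def by simp
  show ?thesis
  proof (cases "\<forall>j. j \<le> l \<and> j < m \<longrightarrow> s j = int j")
    case all: True
    show ?thesis
    proof (cases "l < m")
      case True
      then have "diagonal_code (Suc (2 * l)) m s e"
        unfolding diagonal_code_odd using all l by auto
      then show ?thesis ..
    next
      case False
      \<comment> \<open>Here all earlier exponents are 1, while the last exponent b_m is at least
        e_0 > m, hence at least 2.\<close>
      then have "diagonal_code (2 * m) m s e"
        unfolding diagonal_code_even using all l wide_rowsD(1)[OF w] by auto
      then show ?thesis ..
    qed
  next
    case False
    define j where "j = (LEAST j. j \<le> l \<and> j < m \<and> s j \<noteq> int j)"
    have j: "j \<le> l" "j < m" "s j \<noteq> int j"
      using LeastI_ex[of "\<lambda>j. j \<le> l \<and> j < m \<and> s j \<noteq> int j"] False unfolding j_def by auto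
    have least: "s i = int i" if "i < j" for i
      using not_less_Least[of i "\<lambda>j. j \<le> l \<and> j < m \<and> s j \<noteq> int j"] that j
      unfolding j_def[symmetric] by auto
    have "j \<noteq> 0" using j(3) wide_rowsD(2)[OF w] by (metis of_nat_0)
    then have "diagonal_code (2 * j) m s e"
      unfolding diagonal_code_even using j least l wide_rows_lower(1)[OF w j(2)] by auto
    then show ?thesis ..
  qed
qed

section \<open>Inserting and removing a diagonal\<close>

lemma wide_rows_bottom:
  assumes w: "wide_rows m s e" and l: "int l < e 0"
  shows "wide_rows (Suc m) (bottom_start s) (bottom_end l e)"
  unfolding wide_rows_def
proof (intro conjI allI impI)
  show "bottom_start s j < bottom_end l e j" if "j < Suc m" for j
    using that wide_rowsD(3)[OF w, of "j - 1"] by (cases j) auto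
  \<comment> \<open>For j = 0 the strict growth of the ends is l + 1 < e_0 + 1, which is the
    hypothesis on \<open>l\<close>.\<close>
  fix j assume "Suc j < Suc m"
  then show "bottom_start s j < bottom_start s (Suc j)"
    "bottom_start s (Suc j) \<le> bottom_end l e j" "bottom_end l e j < bottom_end l e (Suc j)"
    using l wide_rowsD(2)[OF w] wide_rowsD(4-6)[OF w, of "j - 1"] by (cases j; simp)+
qed auto

lemma wide_rows_extend:
  assumes w: "wide_rows m s e" and l: "1 \<le> l"
  shows "wide_rows m (extend_start l s) (\<lambda>j. e j + 1)"
  unfolding wide_rows_def
proof (intro conjI allI impI)
  show "1 \<le> m" "extend_start l s 0 = 0"
    using wide_rowsD(1,2)[OF w] l by (auto simp: extend_start_def)
  show "extend_start l s j < e j + 1" if "j < m" for j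
    using that wide_rowsD(3)[OF w that] by (auto simp: extend_start_def)
  fix j assume j: "Suc j < m"
  show "extend_start l s j < extend_start l s (Suc j)"
    "extend_start l s (Suc j) \<le> e j + 1" "e j + 1 < e (Suc j) + 1"
    using wide_rowsD(4-6)[OF w j] by (auto simp: extend_start_def)
qed

lemma sum_extend_start:
  assumes "l \<le> m"
  shows "(\<Sum>j<m. (e j + 1) - extend_start l s j) = (\<Sum>j<m. e j - s j) + int l"
proof -
  have "(\<Sum>j<m. (e j + 1) - extend_start l s j) = (\<Sum>j<m. (e j - s j) + (if j < l then 1 else 0))"
    by (intro sum.cong) (auto simp: extend_start_def)
  also have "\<dots> = (\<Sum>j<m. e j - s j) + (\<Sum>j<m. if j < l then 1 else 0)"
    by (rule sum.distrib)
  also have "(\<Sum>j<m. if j < l then 1 else (0::int)) = (\<Sum>j\<in>{..<m} \<inter> {j. j < l}. 1)"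
    by (simp add: sum.If_cases)
  also have "{..<m} \<inter> {j. j < l} = {..<l}" using assms by auto
  finally show ?thesis by simp
qed

text \<open>The bound \<open>k \<le> k' + 1\<close> is what makes the insertion legal: it gives
  \<open>l \<le> m\<close>, \<open>s j = int j\<close> for j < l, and \<open>int l < e 0\<close> for
  odd k or \<open>int l \<le> e 0\<close> for even k. The remaining conclusions are the invariants
  to be matched with the fountain: its first diagonal, its number of diagonals, its even coins, and
  its even coins minus its odd coins.\<close>

lemma insert_diagonal_row_cells:
  assumes w: "wide_rows m s e" and c: "diagonal_code k' m s e" and k: "1 \<le> k" "k \<le> k' + 1"
  obtains m2 s2 e2 where "insert_diagonal k (row_cells m s e) = row_cells m2 s2 e2"
    "wide_rows m2 s2 e2" "diagonal_code k m2 s2 e2" "e2 (m2 - 1) = e (m - 1) + 1"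
    "(\<Sum>j<m2. e2 j - s2 j) = (\<Sum>j<m. e j - s j) + int ((k + 1) div 2)"
    "int m2 = int m + int ((k + 1) div 2) - int (k div 2)"
proof (cases k rule: parity_cases)
  case (1 l)
  have le0: "int l < e 0" and lm: "l \<le> m" and s: "\<And>j. j < l \<Longrightarrow> s j = int j"
    by (cases k' rule: parity_cases;
        use c k(2) 1 in \<open>auto simp: diagonal_code_odd diagonal_code_even\<close>)+
  have m: "0 < m" using wide_rowsD(1)[OF w] by simp
  have "bottom_start s j = int j" if "j \<le> l" for j using s[of "j - 1"] that by (cases j) auto
  then have "diagonal_code k (Suc m) (bottom_start s) (bottom_end l e)"
    unfolding 1 diagonal_code_odd using lm by auto
  moreover have "bottom_end l e (Suc m - 1) = e (m - 1) + 1" using m by (cases m) auto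
  moreover have "(\<Sum>j<Suc m. bottom_end l e j - bottom_start s j)
      = (\<Sum>j<m. e j - s j) + int ((k + 1) div 2)"
    unfolding sum.lessThan_Suc_shift using 1 by simp
  ultimately show thesis
    using 1 add_bottom_row_row_cells[OF w] wide_rows_bottom[OF w le0]
    by (intro that[of "Suc m" "bottom_start s" "bottom_end l e"]) (simp_all add: insert_diagonal_odd)
next
  case (2 l)
  have l1: "1 \<le> l" using 2 k by simp
  have le0: "int l \<le> e 0" and lm: "l \<le> m" and s: "\<And>j. j < l \<Longrightarrow> s j = int j"
    by (cases k' rule: parity_cases;
        use c k(2) 2 in \<open>auto simp: diagonal_code_odd diagonal_code_even\<close>)+
  have "diagonal_code k m (extend_start l s) (\<lambda>j. e j + 1)"
    unfolding 2 diagonal_code_even using l1 lm le0 s wide_rows_lower(1)[OF w, of l]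
    by (auto simp: extend_start_def)
  then show thesis
    using 2 extend_lowest_rows_row_cells[OF w l1 lm] wide_rows_extend[OF w l1]
      sum_extend_start[OF lm, of e s]
    by (intro that[of m "extend_start l s" "\<lambda>j. e j + 1"]) (simp_all add: insert_diagonal_even)
qed

text \<open>The bounds on \<open>k\<close> make the explicit row data of both insertions available.
  For fixed \<open>k\<close> these data determine the old ones row by row.\<close>

lemma insert_diagonal_inject:
  assumes w: "wide_rows m s e" "wide_rows m' s' e'"
    and c: "diagonal_code k1 m s e" "diagonal_code k2 m' s' e'"
    and k: "1 \<le> k" "k \<le> k1 + 1" "k \<le> k2 + 1"
    and eq: "insert_diagonal k (row_cells m s e) = insert_diagonal k (row_cells m' s' e')"
  shows "row_cells m s e = row_cells m' s' e'"
proof (cases k rule: parity_cases)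
  case (1 l)
  have "int l < e 0" "int l < e' 0"
    by (cases k1 rule: parity_cases; use c k 1 in \<open>auto simp: diagonal_code_odd diagonal_code_even\<close>)
      (cases k2 rule: parity_cases; use c k 1 in \<open>auto simp: diagonal_code_odd diagonal_code_even\<close>)
  note inj = row_cells_inject[OF wide_rows_bottom[OF w(1) this(1)] wide_rows_bottom[OF w(2) this(2)]
      eq[unfolded 1 insert_diagonal_odd add_bottom_row_row_cells[OF w(1)]
        add_bottom_row_row_cells[OF w(2)]]]
  have m: "m' = m" using inj(1) by simp
  show ?thesis unfolding m
  proof (rule row_cells_cong)
    fix j assume "j < m"
    then show "s j = s' j" "e j = e' j" using inj(2)[of "Suc j"] inj(3)[of "Suc j"] by auto
  qed
next
  case (2 l)
  have l1: "1 \<le> l" using 2 k by simp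
  have lm: "l \<le> m" "l \<le> m'"
    by (cases k1 rule: parity_cases; use c k 2 in \<open>auto simp: diagonal_code_odd diagonal_code_even\<close>)
      (cases k2 rule: parity_cases; use c k 2 in \<open>auto simp: diagonal_code_odd diagonal_code_even\<close>)
  note inj = row_cells_inject[OF wide_rows_extend[OF w(1) l1] wide_rows_extend[OF w(2) l1]
      eq[unfolded 2 insert_diagonal_even extend_lowest_rows_row_cells[OF w(1) l1 lm(1)]
        extend_lowest_rows_row_cells[OF w(2) l1 lm(2)]]]
  have m: "m' = m" using inj(1) by simp
  show ?thesis unfolding m
  proof (rule row_cells_cong)
    fix j assume "j < m"
    then show "s j = s' j" "e j = e' j" using inj(2)[of j] inj(3)[of j]
      by (auto simp: extend_start_def split: if_splits)
  qed
qed

text \<open>The diagonal to remove is the one given by the code. The last conclusion is the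
  condition under which a diagonal of size \<open>k\<close> fits in front of a fountain with first
  diagonal k'.\<close>

lemma insert_diagonal_surj:
  assumes w: "wide_rows m s e" and width: "2 \<le> e (m - 1)"
  obtains k m' s' e' where "1 \<le> k" "wide_rows m' s' e'"
    "insert_diagonal k (row_cells m' s' e') = row_cells m s e" "e' (m' - 1) = e (m - 1) - 1"
    "\<And>k'. diagonal_code k' m' s' e' \<Longrightarrow> k \<le> k' + 1"
proof -
  obtain k where c: "diagonal_code k m s e" using diagonal_code_exists[OF w] by blast
  show thesis
  proof (cases k rule: parity_cases)
    case (1 l)
    have l: "l < m" "e 0 = int l + 1" "\<And>j. j \<le> l \<Longrightarrow> s j = int j"
      using c unfolding 1 diagonal_code_odd by auto
    \<comment> \<open>A single row would force l = 0 and e_0 = 1, against the width.\<close>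
    have "m \<noteq> 1" using l width by auto
    then obtain m' where m: "m = Suc m'" "1 \<le> m'" using wide_rowsD(1)[OF w] by (cases m) auto
    define s' where "s' = (\<lambda>j. s (Suc j) - 1)"
    define e' where "e' = (\<lambda>j. e (Suc j) - 1)"
    \<comment> \<open>Once the bottom row is gone, the leftmost column is 1, so shifting by 1
      normalises the rest.\<close>
    have s1: "s (Suc 0) = 1"
      using l(3)[of 1] l(2) wide_rowsD(2)[OF w] wide_rowsD(4,5)[OF w, of 0] m by (cases l) auto
    have w': "wide_rows m' s' e'" unfolding wide_rows_def
    proof (intro conjI allI impI)
      show "1 \<le> m'" "s' 0 = 0" using m s1 by (auto simp: s'_def)
      show "s' j < e' j" if "j < m'" for j
        using wide_rowsD(3)[OF w, of "Suc j"] that m by (simp add: s'_def e'_def)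
      fix j assume "Suc j < m'"
      then show "s' j < s' (Suc j)" "s' (Suc j) \<le> e' j" "e' j < e' (Suc j)"
        using wide_rowsD(4-6)[OF w, of "Suc j"] m by (auto simp: s'_def e'_def)
    qed
    have "row_cells (Suc m') (bottom_start s') (bottom_end l e') = row_cells m s e"
      unfolding m(1)
    proof (rule row_cells_cong)
      fix j
      show "bottom_start s' j = s j" using wide_rowsD(2)[OF w] by (cases j) (auto simp: s'_def)
      show "bottom_end l e' j = e j" using l(2) by (cases j) (auto simp: e'_def)
    qed
    \<comment> \<open>An odd code of the rest is bounded below through e_0 < e_1. An even code 2 l'
      with l' < l would need a departure at row l', but \<open>s (Suc l')\<close> is still l' +
      1.\<close>
    moreover have "k \<le> k' + 1" if "diagonal_code k' m' s' e'" for k'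
    proof (cases k' rule: parity_cases)
      case k': (1 l')
      have "e (Suc 0) = int l' + 2" using that unfolding k' diagonal_code_odd e'_def by simp
      then show ?thesis using wide_rowsD(6)[OF w, of 0] m l(2) 1 k' by simp
    next
      case k': (2 l')
      have "l \<le> l'"
      proof (rule ccontr)
        assume "\<not> l \<le> l'"
        moreover from this have "int l' < s' l'"
          using that l(1) m unfolding k' diagonal_code_even by simp
        ultimately show False using l(3)[of "Suc l'"] by (simp add: s'_def)
      qed
      then show ?thesis using 1 k' by simp
    qed
    ultimately show thesis
      using 1 w' m by (intro that[of k m' s' e'])
        (simp_all add: insert_diagonal_odd add_bottom_row_row_cells e'_def)
  next
    case (2 l)
    have l: "1 \<le> l" "l \<le> m" "int l < e 0" "\<And>j. j < l \<Longrightarrow> s j = int j" "l < m \<Longrightarrow> int l < s l"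
      using c unfolding 2 diagonal_code_even by auto
    define s' where "s' = (\<lambda>j. if j < l then s j else s j - 1)"
    define e' where "e' = (\<lambda>j. e j - 1)"
    have w': "wide_rows m s' e'" unfolding wide_rows_def
    proof (intro conjI allI impI)
      show "1 \<le> m" "s' 0 = 0" using wide_rowsD(1,2)[OF w] l by (auto simp: s'_def)
      show "s' j < e' j" if "j < m" for j
        using wide_rowsD(3)[OF w that] wide_rows_lower(2)[OF w that] l(3) l(4)[of j]
        by (auto simp: s'_def e'_def)
      fix j assume j: "Suc j < m"
      \<comment> \<open>At the seam \<open>Suc j = l\<close> the upper start drops by 1 and the
        lower one does not; \<open>int l < s l\<close> leaves the room.\<close>
      show "s' j < s' (Suc j)"
        using wide_rowsD(4)[OF w j] l(4)[of j] l(5) j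
        by (cases "Suc j = l") (auto simp: s'_def)
      show "s' (Suc j) \<le> e' j"
        using wide_rowsD(5)[OF w j] wide_rows_lower(2)[OF w, of j] l(3) l(4)[of "Suc j"] j
        by (auto simp: s'_def e'_def)
      show "e' j < e' (Suc j)"
        using wide_rowsD(6)[OF w j] by (auto simp: e'_def)
    qed
    have "row_cells m (extend_start l s') (\<lambda>j. e' j + 1) = row_cells m s e"
      by (rule row_cells_cong) (auto simp: s'_def e'_def extend_start_def)
    moreover have "k \<le> k' + 1" if "diagonal_code k' m s' e'" for k'
    proof (cases k' rule: parity_cases)
      case k': (1 l')
      have "e 0 = int l' + 2" using that unfolding k' diagonal_code_odd e'_def by simp
      then show ?thesis using l(3) 2 k' by simp
    next
      case k': (2 l')
      have "l \<le> l'"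
      proof (rule ccontr)
        assume "\<not> l \<le> l'"
        moreover from this have "int l' < s' l'"
          using that l(2) unfolding k' diagonal_code_even by simp
        ultimately show False using l(4)[of l'] by (simp add: s'_def)
      qed
      then show ?thesis using 2 k' by simp
    qed
    ultimately show thesis
      using 2 w' l by (intro that[of k m s' e'])
        (simp_all add: insert_diagonal_even extend_lowest_rows_row_cells e'_def)
  qed
qed


subsection \<open>Coin fountains as sequences of diagonals\<close>

lemma coin_fountainD:
  assumes "coin_fountain C"
  shows "finite C" "1 \<le> num_diagonals C"
    "{a. (a, 0) \<in> C} = {2 * int i | i. i < num_diagonals C}"
    "\<And>a j. (a, Suc j) \<in> C \<Longrightarrow> (a - 1, j) \<in> C \<and> (a + 1, j) \<in> C"
proof -
  from assms obtain d where d: "d \<ge> 1" "{a. (a, 0) \<in> C} = {2 * int i | i. i < d}"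
    unfolding coin_fountain_def by blast
  have "{2 * int i | i. i < d} = (\<lambda>i. 2 * int i) ` {..<d}" by auto
  then have "num_diagonals C = d"
    unfolding num_diagonals_def d(2) by (simp add: card_image inj_on_def)
  with d show "1 \<le> num_diagonals C" "{a. (a, 0) \<in> C} = {2 * int i | i. i < num_diagonals C}"
    by auto
  show "finite C" using assms unfolding coin_fountain_def by blast
  show "(a - 1, j) \<in> C \<and> (a + 1, j) \<in> C" if "(a, Suc j) \<in> C" for a j
    using assms that unfolding coin_fountain_def by (metis diff_Suc_1 le_add1 plus_1_eq_Suc)
qed

lemma coin_fountainI:
  assumes "finite C" "1 \<le> d" "{a. (a, 0) \<in> C} = {2 * int i | i. i < d}"
    "\<And>a j. (a, Suc j) \<in> C \<Longrightarrow> (a - 1, j) \<in> C \<and> (a + 1, j) \<in> C"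
  shows "coin_fountain C" "num_diagonals C = d"
proof -
  show "coin_fountain C" unfolding coin_fountain_def
  proof (intro conjI allI impI)
    show "\<exists>d::nat. d \<ge> 1 \<and> {a. (a, 0) \<in> C} = {2 * int i | i. i < d}" using assms by blast
    fix a j assume "(a, j) \<in> C \<and> 1 \<le> j"
    then show "(a - 1, j - 1) \<in> C" "(a + 1, j - 1) \<in> C" using assms(4)[of a "j - 1"] by auto
  qed fact
  have "{2 * int i | i. i < d} = (\<lambda>i. 2 * int i) ` {..<d}" by auto
  then show "num_diagonals C = d"
    unfolding num_diagonals_def assms(3) by (simp add: card_image inj_on_def)
qed

text \<open>Following the lower left support preserves a - j and ends in the bottom row, so i
  numbers the north-east diagonal of the coin.\<close>

lemma coin_fountain_coord:
  assumes "coin_fountain C" "(a, j) \<in> C"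
  shows "\<exists>i<num_diagonals C. a = int j + 2 * int i"
  using assms(2)
proof (induction j arbitrary: a)
  case 0
  then have "a \<in> {a. (a, 0) \<in> C}" by simp
  then show ?case unfolding coin_fountainD(3)[OF assms(1)] by auto
next
  case (Suc j)
  then have "(a - 1, j) \<in> C" using coin_fountainD(4)[OF assms(1)] by blast
  from Suc.IH[OF this] show ?case by auto
qed

lemma coin_fountain_origin:
  assumes "coin_fountain C"
  shows "(0, 0) \<in> C"
proof -
  have "0 \<in> {a. (a, 0) \<in> C}"
    unfolding coin_fountainD(3)[OF assms] using coin_fountainD(2)[OF assms]
    by (auto intro!: exI[of _ 0])
  then show ?thesis by simp
qed

lemma down_closed_eq_lessThan_card:
  fixes A :: "nat set"
  assumes "finite A" "\<And>j. Suc j \<in> A \<Longrightarrow> j \<in> A"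
  shows "A = {..<card A}"
proof -
  define n where "n = (LEAST n. n \<notin> A)"
  have n: "n \<notin> A" unfolding n_def
    by (rule LeastI_ex) (metis assms(1) infinite_UNIV_nat finite_subset subsetI)
  have "i \<in> A" if "i < n" for i
    using not_less_Least[of i "\<lambda>n. n \<notin> A"] that unfolding n_def by blast
  moreover have "i \<notin> A" if "n \<le> i" for i
    using that by (induction i rule: dec_induct) (use n assms(2) in auto)
  ultimately have "A = {..<n}" by (auto simp: not_le[symmetric])
  then show ?thesis by simp
qed

lemma first_diagonal_iff:
  assumes C: "coin_fountain C"
  shows "(int j, j) \<in> C \<longleftrightarrow> j < first_diagonal_size C"
proof -
  have "finite ((\<lambda>j. (int j, j)) -` C)"
    by (rule finite_vimageI) (auto simp: coin_fountainD(1)[OF C] inj_on_def)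
  then have "finite {j. (int j, j) \<in> C}" by (simp add: vimage_def)
  then have "{j. (int j, j) \<in> C} = {..<first_diagonal_size C}"
    unfolding first_diagonal_size_def
    by (rule down_closed_eq_lessThan_card) (use coin_fountainD(4)[OF C] in force)
  then show ?thesis by auto
qed

lemma first_diagonal_size_pos:
  assumes "coin_fountain C"
  shows "1 \<le> first_diagonal_size C"
  using first_diagonal_iff[OF assms, of 0] coin_fountain_origin[OF assms] by simp

definition add_first_diagonal :: "nat \<Rightarrow> coin set \<Rightarrow> coin set" where
  "add_first_diagonal k C = {(int j, j) | j. j < k} \<union> (\<lambda>(a, j). (a + 2, j)) ` C"

lemma mem_add_first_diagonal:
  "(a, j) \<in> add_first_diagonal k C \<longleftrightarrow> a = int j \<and> j < k \<or> (a - 2, j) \<in> C"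
  unfolding add_first_diagonal_def by (force simp: image_iff)

lemma mem_remove_first_diagonal:
  "(a, j) \<in> remove_first_diagonal C \<longleftrightarrow> (a + 2, j) \<in> C \<and> int j \<le> a"
  unfolding remove_first_diagonal_def by (auto intro!: exI[of _ "a + 2"])

text \<open>For the last claim: the coin (j + 1, j + 1) rests on (j + 2, j), which becomes (j, j)
  after the removal. Hence each diagonal is at most one longer than the next.\<close>

lemma remove_first_diagonal:
  assumes C: "coin_fountain C" and d: "num_diagonals C = Suc (Suc d)"
  shows "coin_fountain (remove_first_diagonal C)" "num_diagonals (remove_first_diagonal C) = Suc d"
    "add_first_diagonal (first_diagonal_size C) (remove_first_diagonal C) = C"
    "first_diagonal_size C \<le> first_diagonal_size (remove_first_diagonal C) + 1"
proof -
  let ?R = "remove_first_diagonal C"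
  have fin: "finite ?R"
    by (rule finite_subset[of _ "(\<lambda>(a, j). (a - 2, j)) ` C"])
      (force simp: remove_first_diagonal_def coin_fountainD(1)[OF C])+
  have base: "{a. (a, 0) \<in> ?R} = {2 * int i | i. i < Suc d}"
  proof (intro equalityI subsetI)
    fix a assume "a \<in> {a. (a, 0) \<in> ?R}"
    then have "(a + 2, 0) \<in> C" "0 \<le> a" by (auto simp: mem_remove_first_diagonal)
    moreover from coin_fountain_coord[OF C this(1)] obtain i
      where "i < Suc (Suc d)" "a + 2 = 2 * int i" using d by auto
    ultimately show "a \<in> {2 * int i | i. i < Suc d}"
      by (cases i) auto
  next
    fix a assume "a \<in> {2 * int i | i. i < Suc d}"
    then obtain i where i: "i < Suc d" "a = 2 * int i" by auto
    have "2 * int (Suc i) \<in> {a. (a, 0) \<in> C}"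
      unfolding coin_fountainD(3)[OF C] d using i by blast
    then show "a \<in> {a. (a, 0) \<in> ?R}"
      using i by (simp add: mem_remove_first_diagonal algebra_simps)
  qed
  have down: "(a - 1, j) \<in> ?R \<and> (a + 1, j) \<in> ?R" if "(a, Suc j) \<in> ?R" for a j
    using that coin_fountainD(4)[OF C, of "a + 2" j]
    by (auto simp: mem_remove_first_diagonal algebra_simps)
  show R: "coin_fountain ?R" and "num_diagonals ?R = Suc d"
    using coin_fountainI[OF fin _ base down] by auto
  \<comment> \<open>Since a - j is even, no coin lies strictly between the first diagonal and the
    part that is kept.\<close>
  have shift: "a = int j \<or> int j + 2 \<le> a" if aj: "(a, j) \<in> C" for a j
  proof -
    obtain i where "a = int j + 2 * int i" using coin_fountain_coord[OF C aj] by blast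
    then show ?thesis by (cases i) auto
  qed
  have "(a, j) \<in> add_first_diagonal (first_diagonal_size C) ?R \<longleftrightarrow> (a, j) \<in> C" for a j
    using first_diagonal_iff[OF C, of j] shift[of a j]
    by (auto simp: mem_add_first_diagonal mem_remove_first_diagonal)
  then show "add_first_diagonal (first_diagonal_size C) ?R = C" by auto
  show "first_diagonal_size C \<le> first_diagonal_size ?R + 1"
  proof (rule ccontr)
    assume *: "\<not> ?thesis"
    let ?j = "first_diagonal_size ?R"
    have "(int (Suc ?j), Suc ?j) \<in> C" using * by (simp only: first_diagonal_iff[OF C])
    then have "(int ?j + 2, ?j) \<in> C"
      using coin_fountainD(4)[OF C, of "int (Suc ?j)" ?j] by (simp add: algebra_simps)
    then have "(int ?j, ?j) \<in> ?R" by (simp add: mem_remove_first_diagonal)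
    then show False by (simp add: first_diagonal_iff[OF R])
  qed
qed

text \<open>A new coin (j + 1, j + 1) needs (j + 2, j) as its right support, that is, the old coin
  (j, j). The upper bound on \<open>k\<close> provides it for every new coin.\<close>

lemma add_first_diagonal:
  assumes C: "coin_fountain C" and k: "1 \<le> k" "k \<le> first_diagonal_size C + 1"
  shows "coin_fountain (add_first_diagonal k C)"
    "num_diagonals (add_first_diagonal k C) = Suc (num_diagonals C)"
    "first_diagonal_size (add_first_diagonal k C) = k"
    "remove_first_diagonal (add_first_diagonal k C) = C"
proof -
  let ?A = "add_first_diagonal k C"
  have "{(int j, j) | j. j < k} = (\<lambda>j. (int j, j)) ` {..<k}" by auto
  then have fin: "finite ?A"
    unfolding add_first_diagonal_def using coin_fountainD(1)[OF C] by simp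
  have base: "{a. (a, 0) \<in> ?A} = {2 * int i | i. i < Suc (num_diagonals C)}"
  proof (intro equalityI subsetI)
    fix a assume "a \<in> {a. (a, 0) \<in> ?A}"
    then consider "a = 0" | "(a - 2, 0) \<in> C" by (auto simp: mem_add_first_diagonal)
    then show "a \<in> {2 * int i | i. i < Suc (num_diagonals C)}"
    proof cases
      case 2
      from coin_fountain_coord[OF C this] obtain i where "i < num_diagonals C" "a - 2 = 2 * int i"
        by auto
      then have "Suc i < Suc (num_diagonals C)" "a = 2 * int (Suc i)" by auto
      then show ?thesis by blast
    qed auto
  next
    fix a assume "a \<in> {2 * int i | i. i < Suc (num_diagonals C)}"
    then obtain i where i: "i < Suc (num_diagonals C)" "a = 2 * int i" by auto
    show "a \<in> {a. (a, 0) \<in> ?A}"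
    proof (cases i)
      case 0
      then show ?thesis using i k by (simp add: mem_add_first_diagonal)
    next
      case (Suc n)
      have "2 * int n \<in> {a. (a, 0) \<in> C}"
        unfolding coin_fountainD(3)[OF C] using i Suc by blast
      then show ?thesis using i Suc by (simp add: mem_add_first_diagonal)
    qed
  qed
  have down: "(a - 1, j) \<in> ?A \<and> (a + 1, j) \<in> ?A" if "(a, Suc j) \<in> ?A" for a j
  proof (cases "a = int (Suc j) \<and> Suc j < k")
    case True
    then have "(int j, j) \<in> C" using k by (simp add: first_diagonal_iff[OF C])
    then show ?thesis using True by (simp add: mem_add_first_diagonal)
  next
    case False
    then have "(a - 2, Suc j) \<in> C" using that by (auto simp: mem_add_first_diagonal)
    from coin_fountainD(4)[OF C this] show ?thesis by (simp add: mem_add_first_diagonal)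
  qed
  show A: "coin_fountain ?A" and "num_diagonals ?A = Suc (num_diagonals C)"
    using coin_fountainI[OF fin _ base down] by auto
  have ge: "int j \<le> a" if "(a, j) \<in> C" for a j using coin_fountain_coord[OF C that] by auto
  have "{j. (int j, j) \<in> ?A} = {..<k}"
    using ge by (force simp: mem_add_first_diagonal)
  then show "first_diagonal_size ?A = k" unfolding first_diagonal_size_def by simp
  show "remove_first_diagonal ?A = C"
    using ge by (force simp: mem_add_first_diagonal mem_remove_first_diagonal)
qed

lemma coin_fountain_single:
  assumes C: "coin_fountain C" and d: "num_diagonals C = 1"
  shows "C = {(0, 0)}"
proof -
  have "a = 0 \<and> j = 0" if "(a, j) \<in> C" for a j
  proof -
    have a: "b = int i" if "(b, i) \<in> C" for b i
      using coin_fountain_coord[OF C that] d by simp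
    show ?thesis
    proof (cases j)
      case 0
      then show ?thesis using a[OF that] by simp
    next
      \<comment> \<open>The two supports of such a coin would lie on different diagonals.\<close>
      case (Suc i)
      then show ?thesis
        using coin_fountainD(4)[OF C, of a i] that a[of "a - 1" i] a[of "a + 1" i] by simp
    qed
  qed
  then show ?thesis using coin_fountain_origin[OF C] by auto
qed

lemma single_coin:
  "coin_fountain {(0, 0)}" "num_diagonals {(0, 0)} = 1" "first_diagonal_size {(0, 0)} = 1"
  "even_coins {(0, 0)} = 1" "odd_coins {(0, 0)} = 0"
proof -
  have "{a. (a, 0) \<in> {(0, 0)}} = {2 * int i | i. i < (1::nat)}" by auto
  from coin_fountainI[OF _ _ this]
  show "coin_fountain {(0, 0)}" "num_diagonals {(0, 0)} = 1" by auto
  have "{j. (int j, j) \<in> {(0, 0)}} = {0}" by auto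
  then show "first_diagonal_size {(0, 0)} = 1" unfolding first_diagonal_size_def by simp
  have parts: "{(a, j). (a, j) \<in> {(0::int, 0::nat)} \<and> even j} = {(0, 0)}"
    "{(a, j). (a, j) \<in> {(0::int, 0::nat)} \<and> odd j} = {}" by (auto intro: odd_pos)
  show "even_coins {(0, 0)} = 1" "odd_coins {(0, 0)} = 0"
    unfolding even_coins_def odd_coins_def parts by simp_all
qed

section \<open>Counting coins by the parity of their row\<close>

lemma card_even_less: "card {j. j < k \<and> even j} = (k + 1) div 2"
  and card_odd_less: "card {j. j < k \<and> odd j} = k div 2" for k :: nat
proof (induction k)
  case (Suc k)
  have "{j. j < Suc k \<and> even j} = (if even k then insert k else id) {j. j < k \<and> even j}"
    "{j. j < Suc k \<and> odd j} = (if odd k then insert k else id) {j. j < k \<and> odd j}"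
    by (auto simp: less_Suc_eq)
  then show "card {j. j < Suc k \<and> even j} = (Suc k + 1) div 2"
    "card {j. j < Suc k \<and> odd j} = Suc k div 2" using Suc by auto
qed auto

lemma card_filter_add_first_diagonal:
  assumes C: "coin_fountain C"
  shows "card {(a, j). (a, j) \<in> add_first_diagonal k C \<and> p j}
    = card {j. j < k \<and> p j} + card {(a, j). (a, j) \<in> C \<and> p j}"
proof -
  let ?D = "(\<lambda>j. (int j, j)) ` {j. j < k \<and> p j}"
  let ?S = "(\<lambda>(a, j). (a + 2, j)) ` {(a, j). (a, j) \<in> C \<and> p j}"
  have "finite {(a, j). (a, j) \<in> C \<and> p j}"
    by (rule finite_subset[OF _ coin_fountainD(1)[OF C]]) auto
  moreover have "int j \<le> a" if "(a, j) \<in> C" for a j using coin_fountain_coord[OF C that] by auto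
  then have "?D \<inter> ?S = {}" by fastforce
  moreover have "{(a, j). (a, j) \<in> add_first_diagonal k C \<and> p j} = ?D \<union> ?S"
    unfolding add_first_diagonal_def by auto
  ultimately have "card {(a, j). (a, j) \<in> add_first_diagonal k C \<and> p j} = card ?D + card ?S"
    by (simp add: card_Un_disjoint)
  moreover have "inj_on (\<lambda>(a::int, j::nat). (a + 2, j)) A" for A by (auto simp: inj_on_def)
  ultimately show ?thesis by (simp add: card_image inj_on_def[of "\<lambda>j. (int j, j)"])
qed

lemma even_coins_add_first_diagonal:
  "coin_fountain C \<Longrightarrow> even_coins (add_first_diagonal k C) = (k + 1) div 2 + even_coins C"
  unfolding even_coins_def by (simp only: card_filter_add_first_diagonal card_even_less)

lemma odd_coins_add_first_diagonal:
  "coin_fountain C \<Longrightarrow> odd_coins (add_first_diagonal k C) = k div 2 + odd_coins C"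
  unfolding odd_coins_def by (simp only: card_filter_add_first_diagonal card_odd_less)

subsection \<open>The bijection\<close>

lemma fountain_to_stanley_single: "fountain_to_stanley {(0, 0)} = row_cells 1 (\<lambda>_. 0) (\<lambda>_. 1)"
  unfolding fountain_to_stanley_def single_coin(2) by auto

lemma fountain_to_stanley_step:
  assumes C: "coin_fountain C" and d: "num_diagonals C = Suc (Suc d)"
  shows "fountain_to_stanley C
    = insert_diagonal (first_diagonal_size C) (fountain_to_stanley (remove_first_diagonal C))"
  unfolding fountain_to_stanley_def d remove_first_diagonal(2)[OF C d]
  by (simp add: Let_def insert_diagonal_def)

text \<open>Induction on the number of diagonals. Carrying the code along supplies the bound
  required by the next insertion, because consecutive diagonals differ as
  \<open>remove_first_diagonal\<close> states.\<close>

lemma fountain_to_stanley_row_cells: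
  assumes "coin_fountain C"
  obtains m s e where "fountain_to_stanley C = row_cells m s e" "wide_rows m s e"
    "diagonal_code (first_diagonal_size C) m s e" "e (m - 1) = int (num_diagonals C)"
    "(\<Sum>j<m. e j - s j) = int (even_coins C)" "int m = int (even_coins C) - int (odd_coins C)"
proof -
  have "\<exists>m s e. fountain_to_stanley C = row_cells m s e \<and> wide_rows m s e \<and>
    diagonal_code (first_diagonal_size C) m s e \<and> e (m - 1) = int (num_diagonals C) \<and>
    (\<Sum>j<m. e j - s j) = int (even_coins C) \<and> int m = int (even_coins C) - int (odd_coins C)"
    if "coin_fountain C" "num_diagonals C = Suc d" for C d
    using that
  proof (induction d arbitrary: C)
    case 0
    then have "C = {(0, 0)}" by (intro coin_fountain_single) auto
    then show ?case
      by (intro exI[of _ 1] exI[of _ "\<lambda>_. 0"] exI[of _ "\<lambda>_. 1"])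
        (simp add: fountain_to_stanley_single single_coin wide_rows_def diagonal_code_def del: mem_row_cells)
  next
    case (Suc d)
    note C = Suc.prems
    let ?R = "remove_first_diagonal C" and ?k = "first_diagonal_size C"
    note R = remove_first_diagonal[OF C]
    obtain m s e where ind: "fountain_to_stanley ?R = row_cells m s e" "wide_rows m s e"
      "diagonal_code (first_diagonal_size ?R) m s e" "e (m - 1) = int (num_diagonals ?R)"
      "(\<Sum>j<m. e j - s j) = int (even_coins ?R)" "int m = int (even_coins ?R) - int (odd_coins ?R)"
      using Suc.IH[OF R(1,2)] by blast
    obtain m2 s2 e2 where step: "insert_diagonal ?k (row_cells m s e) = row_cells m2 s2 e2"
      "wide_rows m2 s2 e2" "diagonal_code ?k m2 s2 e2" "e2 (m2 - 1) = e (m - 1) + 1"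
      "(\<Sum>j<m2. e2 j - s2 j) = (\<Sum>j<m. e j - s j) + int ((?k + 1) div 2)"
      "int m2 = int m + int ((?k + 1) div 2) - int (?k div 2)"
      using insert_diagonal_row_cells[OF ind(2,3) first_diagonal_size_pos[OF C(1)] R(4)] .
    have "even_coins C = (?k + 1) div 2 + even_coins ?R" "odd_coins C = ?k div 2 + odd_coins ?R"
      using even_coins_add_first_diagonal[OF R(1), of ?k] odd_coins_add_first_diagonal[OF R(1), of ?k]
      unfolding R(3) .
    then show ?case
      using step ind(1,4-6) C R(2) fountain_to_stanley_step[OF C]
      by (intro exI[of _ m2] exI[of _ s2] exI[of _ e2]) simp
  qed
  moreover have "num_diagonals C = Suc (num_diagonals C - 1)"
    using coin_fountainD(2)[OF assms] by simp
  ultimately show thesis using that assms by blast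
qed

text \<open>The number of diagonals is the end of the top row, and the first diagonal is the unique
  code of the image. This lets the injectivity proof peel off equal diagonals on both sides.\<close>

lemma fountain_to_stanley_eqD:
  assumes C: "coin_fountain C" "coin_fountain C'"
    and eq: "fountain_to_stanley C = fountain_to_stanley C'"
  shows "num_diagonals C = num_diagonals C'" "first_diagonal_size C = first_diagonal_size C'"
proof -
  obtain m s e where 1: "fountain_to_stanley C = row_cells m s e" "wide_rows m s e"
    "diagonal_code (first_diagonal_size C) m s e" "e (m - 1) = int (num_diagonals C)"
    using fountain_to_stanley_row_cells[OF C(1)] by metis
  obtain m' s' e' where 2: "fountain_to_stanley C' = row_cells m' s' e'" "wide_rows m' s' e'"
    "diagonal_code (first_diagonal_size C') m' s' e'" "e' (m' - 1) = int (num_diagonals C')"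
    using fountain_to_stanley_row_cells[OF C(2)] by metis
  note inj = row_cells_inject[OF 1(2) 2(2) eq[unfolded 1(1) 2(1)]]
  have m: "1 \<le> m" by (rule wide_rowsD(1)[OF 1(2)])
  show "num_diagonals C = num_diagonals C'"
    using inj(1) inj(3)[of "m - 1"] 1(4) 2(4) m by simp
  have "diagonal_code (first_diagonal_size C') m s e"
    using 2(3) inj m unfolding diagonal_code_def by (auto split: if_splits)
  with 1(3) show "first_diagonal_size C = first_diagonal_size C'" by (rule diagonal_code_unique)
qed

lemma inj_on_fountain_to_stanley: "inj_on fountain_to_stanley {C. coin_fountain C}"
proof -
  have "C = C'" if "coin_fountain C" "coin_fountain C'" "num_diagonals C = Suc d"
    "fountain_to_stanley C = fountain_to_stanley C'" for C C' d
    using that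
  proof (induction d arbitrary: C C')
    case 0
    then show ?case
      using fountain_to_stanley_eqD(1)[OF 0(1,2,4)] coin_fountain_single by (metis One_nat_def)
  next
    case (Suc d)
    let ?R = "remove_first_diagonal C" and ?R' = "remove_first_diagonal C'"
      and ?k = "first_diagonal_size C"
    note C = Suc.prems(1,3)
    have C': "coin_fountain C'" "num_diagonals C' = Suc (Suc d)"
      and k: "first_diagonal_size C' = ?k"
      using Suc.prems fountain_to_stanley_eqD[OF Suc.prems(1,2,4)] by auto
    note R = remove_first_diagonal[OF C] and R' = remove_first_diagonal[OF C', unfolded k]
    obtain m s e where 1: "fountain_to_stanley ?R = row_cells m s e" "wide_rows m s e"
      "diagonal_code (first_diagonal_size ?R) m s e"
      using fountain_to_stanley_row_cells[OF R(1)] by metis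
    obtain m' s' e' where 2: "fountain_to_stanley ?R' = row_cells m' s' e'" "wide_rows m' s' e'"
      "diagonal_code (first_diagonal_size ?R') m' s' e'"
      using fountain_to_stanley_row_cells[OF R'(1)] by metis
    have "insert_diagonal ?k (row_cells m s e) = insert_diagonal ?k (row_cells m' s' e')"
      using Suc.prems(4)
      unfolding fountain_to_stanley_step[OF C] fountain_to_stanley_step[OF C'] k 1(1) 2(1) .
    from insert_diagonal_inject[OF 1(2) 2(2) 1(3) 2(3) first_diagonal_size_pos[OF C(1)] R(4) R'(4) this]
    have "fountain_to_stanley ?R = fountain_to_stanley ?R'" unfolding 1(1) 2(1) .
    from Suc.IH[OF R(1) R'(1) R(2) this] have "?R = ?R'" .
    with R(3) R'(3) show ?case by metis
  qed
  moreover have "num_diagonals C = Suc (num_diagonals C - 1)" if "coin_fountain C" for C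
    using coin_fountainD(2)[OF that] by simp
  ultimately show ?thesis by (intro inj_onI) blast
qed

text \<open>Induction on the end of the top row: the coded diagonal is removed from the polyomino,
  and a diagonal of the same size is added to a fountain for the rest.\<close>

lemma fountain_to_stanley_surj:
  assumes "wide_rows m s e"
  obtains C where "coin_fountain C" "fountain_to_stanley C = row_cells m s e"
proof -
  have "\<exists>C. coin_fountain C \<and> fountain_to_stanley C = row_cells m s e"
    if "wide_rows m s e" "e (m - 1) = int (Suc d)" for m s e d
    using that
  proof (induction d arbitrary: m s e)
    case 0
    note w = 0(1)
    \<comment> \<open>Otherwise the top row would end at e_0 + m - 1 \<ge> 2 or beyond.\<close>
    have "m = 1"
    proof (rule ccontr)
      assume "m \<noteq> 1"
      then have "m - 1 < m" "0 < m - 1" using wide_rowsD(1)[OF w] by auto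
      then show False
        using wide_rows_lower(2)[OF w, of "m - 1"] wide_rowsD(2)[OF w] wide_rowsD(3)[OF w, of 0] 0(2)
        by simp
    qed
    then have "row_cells m s e = row_cells 1 (\<lambda>_. 0) (\<lambda>_. 1)"
      using wide_rowsD(2)[OF w] 0(2) by (auto intro!: row_cells_cong simp del: mem_row_cells)
    then show ?case using fountain_to_stanley_single single_coin(1) by metis
  next
    case (Suc d)
    have "2 \<le> e (m - 1)" using Suc.prems(2) by simp
    obtain k m' s' e' where k: "1 \<le> k" "wide_rows m' s' e'"
      "insert_diagonal k (row_cells m' s' e') = row_cells m s e" "e' (m' - 1) = e (m - 1) - 1"
      "\<And>k'. diagonal_code k' m' s' e' \<Longrightarrow> k \<le> k' + 1"
      by (rule insert_diagonal_surj[OF Suc.prems(1) \<open>2 \<le> e (m - 1)\<close>]) blast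
    obtain C where C: "coin_fountain C" "fountain_to_stanley C = row_cells m' s' e'"
      using Suc.IH[OF k(2)] k(4) Suc.prems(2) by auto
    obtain m2 s2 e2 where 2: "fountain_to_stanley C = row_cells m2 s2 e2" "wide_rows m2 s2 e2"
      "diagonal_code (first_diagonal_size C) m2 s2 e2"
      using fountain_to_stanley_row_cells[OF C(1)] by metis
    note inj = row_cells_inject[OF 2(2) k(2) trans[OF 2(1)[symmetric] C(2)]]
    \<comment> \<open>The code is known for the row data obtained from \<open>C\<close>. It
      transfers because it inspects only rows below the number of rows, where both data
      agree.\<close>
    have "diagonal_code (first_diagonal_size C) m' s' e'"
      using 2(3) inj wide_rowsD(1)[OF 2(2)] unfolding diagonal_code_def by (auto split: if_splits)
    then have le: "k \<le> first_diagonal_size C + 1" by (rule k(5))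
    note A = add_first_diagonal[OF C(1) k(1) le]
    obtain d' where "num_diagonals C = Suc d'" using coin_fountainD(2)[OF C(1)] by (cases "num_diagonals C") auto
    then have "fountain_to_stanley (add_first_diagonal k C) = row_cells m s e"
      using fountain_to_stanley_step[OF A(1)] A k(3) C(2) by simp
    then show ?case using A(1) by blast
  qed
  moreover have "\<exists>d. e (m - 1) = int (Suc d)"
    using wide_rows_lower[OF assms, of "m - 1"] wide_rowsD(1,2)[OF assms] wide_rowsD(3)[OF assms, of "m - 1"]
    by (intro exI[of _ "nat (e (m - 1)) - 1"]) auto
  ultimately show thesis using that assms by blast
qed

text \<open>By \<open>delest_viennot_shear\<close> the path of the sheared polyomino is the Dyck
  path of \<open>fountain_to_stanley C\<close>, so the two inverses in \<open>psi\<close> cancel in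
  turn.\<close>

lemma psi_shear:
  assumes "coin_fountain C"
  shows "psi (shear (fountain_to_stanley C)) = C"
proof -
  obtain m s e where Q: "fountain_to_stanley C = row_cells m s e" "wide_rows m s e"
    using fountain_to_stanley_row_cells[OF assms] by metis
  have "the_inv_into {Q. stanley_polyomino Q} stanley_to_dyck
      (delest_viennot (shear (fountain_to_stanley C))) = fountain_to_stanley C"
    unfolding Q(1) delest_viennot_shear[OF Q(2)]
    using stanley_polyomino_row_cells[OF Q(2)]
    by (intro the_inv_into_f_f inj_on_stanley_to_dyck) simp
  then show ?thesis
    unfolding psi_def using assms by (simp add: the_inv_into_f_f inj_on_fountain_to_stanley)
qed

lemma parallelogram_polyomino_shear_fountain:
  assumes "coin_fountain C"
  shows "parallelogram_polyomino (shear (fountain_to_stanley C))"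
    "area (shear (fountain_to_stanley C)) = even_coins C"
    "int (num_columns (shear (fountain_to_stanley C))) = int (even_coins C) - int (odd_coins C)"
proof -
  obtain m s e where Q: "fountain_to_stanley C = row_cells m s e" "wide_rows m s e"
    "(\<Sum>j<m. e j - s j) = int (even_coins C)" "int m = int (even_coins C) - int (odd_coins C)"
    using fountain_to_stanley_row_cells[OF assms] by metis
  then show "parallelogram_polyomino (shear (fountain_to_stanley C))"
    "area (shear (fountain_to_stanley C)) = even_coins C"
    "int (num_columns (shear (fountain_to_stanley C))) = int (even_coins C) - int (odd_coins C)"
    using parallelogram_polyomino_shear[OF Q(2)] area_shear[OF Q(2)] num_columns_shear[OF Q(2)]
    by simp_all
qed

theorem theorem2p13:
  fixes n k :: nat
  assumes "n \<ge> 1" and "k \<ge> 1"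
  shows "bij_betw psi
           {P. parallelogram_polyomino P \<and> area P = n \<and> num_columns P = k}
           {C. coin_fountain C \<and> even_coins C = n \<and> int (odd_coins C) = int n - int k}"
    (is "bij_betw psi ?A ?B")
proof -
  \<comment> \<open>The inverse of \<open>psi\<close>, free of Dyck paths. Area and columns of its
    values are already expressed by the coin counts.\<close>
  let ?g = "\<lambda>C. shear (fountain_to_stanley C)"
  have ex: "\<exists>C. coin_fountain C \<and> P = ?g C" if P: "parallelogram_polyomino P" for P
  proof -
    obtain m s e where w: "wide_rows m s e" and "P = shear (row_cells m s e)"
      using P by (rule parallelogram_polyomino_imp_shear)
    then show ?thesis using fountain_to_stanley_surj[OF w] by metis
  qed
  have psi_A: "psi P \<in> ?B \<and> ?g (psi P) = P" if P: "P \<in> ?A" for P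
  proof -
    obtain C where C: "coin_fountain C" "P = ?g C" using ex P by blast
    then show ?thesis using P psi_shear[OF C(1)] parallelogram_polyomino_shear_fountain[OF C(1)] by simp
  qed
  show ?thesis
  proof (rule bij_betw_byWitness[where f' = ?g])
    show "\<forall>P\<in>?A. ?g (psi P) = P" "psi ` ?A \<subseteq> ?B" using psi_A by blast+
    show "\<forall>C\<in>?B. psi (?g C) = C" using psi_shear by blast
    show "?g ` ?B \<subseteq> ?A"
    proof
      fix P assume "P \<in> ?g ` ?B"
      then obtain C where "C \<in> ?B" "P = ?g C" by blast
      then show "P \<in> ?A" using parallelogram_polyomino_shear_fountain[of C] by simp
    qed
  qed
qed

end
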